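(* Let $k\in\mathbb N$ be fixed. For an $N\times N$ unitary matrix $U$ and a fixed $\theta\in\mathbb R$ let $Z=Z(U,\theta)=\det(I-Ue^{-i\theta})$. As $N\to\infty$, the value distribution of $\log|Z|$ is asymptotically Gaussian with mean $k\log N$ and variance $\frac12\log N$ with respect to the measure $|Z|^{2k}d_{Haar}$ on $U(N)$; that is, for every fixed $V\in\mathbb R$, $$\lim_{N\to\infty}\frac{\mathbb E_{U(N)}\Big[|Z|^{2k}\,\mathbf 1\Big\{\tfrac{\log|Z|-k\log N}{\sqrt{\frac12\log N}}\ge V\Big\}\Big]}{\mathbb E_{U(N)}\big[|Z|^{2k}\big]}=\int_V^\infty e^{-x^2/2}\frac{dx}{\sqrt{2\pi}},$$ where $\mathbb E_{U(N)}$ denotes expectation with respect to Haar probability measure on the unitary group $U(N)$ (the circular unitary ensemble). *)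

theory Defs
  imports "HOL-Probability.Probability_Measure" "Jordan_Normal_Form.Determinant"
begin

text \<open>N x N complex matrices are represented as functions nat \<times> nat \<Rightarrow> complex
  that vanish outside {..<N} \<times> {..<N}; this space carries the product (= Euclidean on the
  finitely many non-zero coordinates) topology and its Borel sigma algebra.\<close>

definition mat_mult :: "nat \<Rightarrow> (nat \<times> nat \<Rightarrow> complex) \<Rightarrow> (nat \<times> nat \<Rightarrow> complex) \<Rightarrow> (nat \<times> nat \<Rightarrow> complex)" where
  "mat_mult N A B = (\<lambda>(i,j). \<Sum>l<N. A (i,l) * B (l,j))"

definition mat_adj :: "(nat \<times> nat \<Rightarrow> complex) \<Rightarrow> (nat \<times> nat \<Rightarrow> complex)" where
  "mat_adj A = (\<lambda>(i,j). cnj (A (j,i)))"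

definition mat_id :: "nat \<Rightarrow> (nat \<times> nat \<Rightarrow> complex)" where
  "mat_id N = (\<lambda>(i,j). if i = j \<and> i < N then 1 else 0)"

definition unitary_group :: "nat \<Rightarrow> (nat \<times> nat \<Rightarrow> complex) set" where
  "unitary_group N = {A. (\<forall>i j. (N \<le> i \<or> N \<le> j) \<longrightarrow> A (i,j) = 0) \<and>
                          mat_mult N (mat_adj A) A = mat_id N}"

definition haar :: "nat \<Rightarrow> (nat \<times> nat \<Rightarrow> complex) measure" where
  "haar N = (THE \<mu>. sets \<mu> = sets (restrict_space borel (unitary_group N)) \<and> prob_space \<mu> \<and>
      (\<forall>V \<in> unitary_group N. distr \<mu> \<mu> (mat_mult N V) = \<mu>))"

definition charpoly_Z :: "nat \<Rightarrow> (nat \<times> nat \<Rightarrow> complex) \<Rightarrow> real \<Rightarrow> complex" where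
  "charpoly_Z N U \<theta> = Determinant.det (Matrix.mat N N
      (\<lambda>(i,j). (if i = j then 1 else 0) - U (i,j) * exp (- \<i> * complex_of_real \<theta>)))"

end

theory Submission
  imports Defs "HOL-Probability.Probability"
begin

text \<open>Haar measure is built by recursion on the dimension. If \<open>v\<close> is uniform on the unit sphere
  of \<open>\<complex>\<^sup>n\<^sup>+\<^sup>1\<close>, \<open>W\<close> is Haar distributed on \<open>U(n)\<close> and independent of \<open>v\<close>, and \<open>R(v)\<close> is the
  unitary rank-one perturbation of the identity that maps the last basis vector to \<open>v\<close>, then
  \<open>R(v) (W \<oplus> 1)\<close> is Haar distributed on \<open>U(n + 1)\<close>, because \<open>g R(v) = R(g v) (W' \<oplus> 1)\<close> for some
  \<open>W'\<close> in \<open>U(n)\<close>. Column operations give \<open>det (I - R(v) (W \<oplus> 1)) = (1 - v\<^sub>n) det (I - W)\<close>, so that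
  \<open>|Z|\<close> is a product of independent factors \<open>|1 - v\<^sub>n|\<close>, and \<open>E |Z|\<^sup>s\<close> is the product over
  \<open>j = 1, \<dots>, N\<close> of the expectations of the \<open>s\<close>-th powers of the factors (Bourgade, Hughes,
  Nikeghbali, Yor). With \<open>s = 2 k + i \<tau>\<close> and \<open>a = s / 2\<close>, unitary invariance yields the moments of
  a coordinate of a point on the sphere, and these show that the \<open>j\<close>-th expectation is
  \<open>1 + a\<^sup>2 / j + O(j\<^sup>-\<^sup>3\<^sup>/\<^sup>2)\<close>. Since \<open>a\<^sup>2 - k\<^sup>2 = i k \<tau> - \<tau>\<^sup>2 / 4\<close>, the characteristic function of
  \<open>log |Z|\<close> under the tilted measure is \<open>exp ((i k \<tau> - \<tau>\<^sup>2 / 4) log N)\<close> up to a factor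
  tending to \<open>1\<close> as \<open>\<tau> \<rightarrow> 0\<close>, and Levy's continuity theorem applies.\<close>

subsection \<open>The unitary group\<close>


text \<open>Since \<open>haar\<close> is a definite description, nothing can be said about it before
  existence and uniqueness of a left-invariant probability are established. The construction chosen
  for existence is one along which the determinant factorises. The factor expectations have closed
  forms in Gamma values, but only an expansion to order \<open>1 / j\<close> with a summable error
  is required, uniformly for \<open>\<bar>\<tau>\<bar> \<le> 1\<close>. Second and fourth moments of
  a coordinate suffice for that: they bound the third absolute moment by a multiple of
  \<open>j powr (-3/2)\<close>. The obstacle in the limit is that the number of factors and the
  frequency \<open>\<tau>\<close> (of order \<open>1 / sqrt (log N)\<close>) change together with
  \<open>N\<close>. Each factor is therefore divided by \<open>exp (a^2 / j)\<close>. The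
  exponentials multiply to an exact expression in the harmonic number \<open>harm N\<close>, which
  carries all of the divergence; the remaining product, compared with its value at
  \<open>\<tau> = 0\<close>, has a summable majorant independent of \<open>N\<close>, so that
  Tannery's theorem applies.\<close>

definition mat_vec :: "nat \<Rightarrow> (nat \<times> nat \<Rightarrow> complex) \<Rightarrow> (nat \<Rightarrow> complex) \<Rightarrow> nat \<Rightarrow> complex" where
  "mat_vec N A x = (\<lambda>i. \<Sum>l<N. A (i,l) * x l)"

definition unit_sphere :: "nat \<Rightarrow> (nat \<Rightarrow> complex) set" where
  "unit_sphere N = {v. (\<forall>i\<ge>N. v i = 0) \<and> (\<Sum>i<N. (cmod (v i))\<^sup>2) = 1}"

text \<open>Changing one entry suffices to form the block sum of \<open>W\<close> and 1, because
  elements of \<open>unitary_group n\<close> already vanish outside the leading \<open>n\<close> by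
  \<open>n\<close> block.\<close>

definition mat_extend :: "nat \<Rightarrow> (nat \<times> nat \<Rightarrow> complex) \<Rightarrow> (nat \<times> nat \<Rightarrow> complex)" where
  "mat_extend n W = W((n,n) := 1)"

text \<open>The rank-one perturbation of the identity that is unitary and maps the last basis vector
  \<open>e\<^sub>n\<close> to \<open>v\<close>. For \<open>v = e\<^sub>n\<close> the division by zero makes it the identity, as it should be.\<close>

definition reflection :: "nat \<Rightarrow> (nat \<Rightarrow> complex) \<Rightarrow> (nat \<times> nat \<Rightarrow> complex)" where
  "reflection n v = (let u = (\<lambda>i. (if i = n then 1 else 0) - v i) in
     (\<lambda>(i,j). mat_id (Suc n) (i,j) - u i * cnj (u j) / cnj (u n)))"

lemma mat_mult_assoc: "mat_mult N (mat_mult N A B) C = mat_mult N A (mat_mult N B C)"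
proof
  fix p :: "nat \<times> nat"
  obtain i j where p: "p = (i,j)" by force
  have "mat_mult N (mat_mult N A B) C p = (\<Sum>l<N. \<Sum>m<N. A (i,m) * B (m,l) * C (l,j))"
    by (simp add: mat_mult_def p sum_distrib_right)
  also have "\<dots> = (\<Sum>m<N. \<Sum>l<N. A (i,m) * B (m,l) * C (l,j))"
    by (rule sum.swap)
  also have "\<dots> = mat_mult N A (mat_mult N B C) p"
    by (simp add: mat_mult_def p sum_distrib_left mult.assoc)
  finally show "mat_mult N (mat_mult N A B) C p = mat_mult N A (mat_mult N B C) p" .
qed

lemma mat_vec_mat_mult: "mat_vec N (mat_mult N A B) x = mat_vec N A (mat_vec N B x)"
proof
  fix i
  have "mat_vec N (mat_mult N A B) x i = (\<Sum>l<N. \<Sum>m<N. A (i,m) * B (m,l) * x l)"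
    by (simp add: mat_mult_def mat_vec_def sum_distrib_right)
  also have "\<dots> = (\<Sum>m<N. \<Sum>l<N. A (i,m) * B (m,l) * x l)"
    by (rule sum.swap)
  finally show "mat_vec N (mat_mult N A B) x i = mat_vec N A (mat_vec N B x) i"
    by (simp add: mat_vec_def sum_distrib_left mult.assoc)
qed

lemma mat_adj_mult: "mat_adj (mat_mult N A B) = mat_mult N (mat_adj B) (mat_adj A)"
  by (rule ext) (auto simp: mat_adj_def mat_mult_def mult.commute split: prod.splits)

lemma mat_adj_adj [simp]: "mat_adj (mat_adj A) = A"
  by (rule ext) (auto simp: mat_adj_def split: prod.splits)

lemma mat_id_mult: 
  assumes "\<And>i j. N \<le> i \<Longrightarrow> A (i,j) = 0"
  shows "mat_mult N (mat_id N) A = A"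
proof
  fix p :: "nat \<times> nat"
  obtain i j where p: "p = (i,j)" by force
  have "mat_mult N (mat_id N) A p = (\<Sum>l<N. if i = l then A (l,j) else 0)"
    unfolding mat_mult_def p mat_id_def prod.case by (rule sum.cong) auto
  then show "mat_mult N (mat_id N) A p = A p" using assms by (auto simp: p)
qed

lemma mat_id_vec: 
  assumes "\<And>i. N \<le> i \<Longrightarrow> x i = 0"
  shows "mat_vec N (mat_id N) x = x"
proof
  fix i
  have "mat_vec N (mat_id N) x i = (\<Sum>l<N. if i = l then x l else 0)"
    unfolding mat_vec_def mat_id_def prod.case by (rule sum.cong) auto
  then show "mat_vec N (mat_id N) x i = x i" using assms by auto
qed

lemma unitary_groupD:
  assumes "A \<in> unitary_group N"
  shows "N \<le> i \<Longrightarrow> A (i,j) = 0" "N \<le> j \<Longrightarrow> A (i,j) = 0"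
    "mat_mult N (mat_adj A) A = mat_id N"
  using assms by (auto simp: unitary_group_def)

lemma unitary_id_mult: "A \<in> unitary_group N \<Longrightarrow> mat_mult N (mat_id N) A = A"
  by (rule mat_id_mult) (rule unitary_groupD(1))

lemma mat_adj_id: "mat_adj (mat_id N) = mat_id N"
  by (rule ext) (auto simp: mat_adj_def mat_id_def)

lemma mat_id_unitary: "mat_id N \<in> unitary_group N"
proof -
  have "mat_mult N (mat_id N) (mat_id N) = mat_id N"
    by (rule mat_id_mult) (simp add: mat_id_def)
  then show ?thesis
    by (simp add: unitary_group_def mat_adj_id) (simp add: mat_id_def)
qed

lemma mat_mult_unitary:
  assumes A: "A \<in> unitary_group N" and B: "B \<in> unitary_group N"
  shows "mat_mult N A B \<in> unitary_group N"
proof -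
  have "mat_mult N (mat_adj (mat_mult N A B)) (mat_mult N A B)
      = mat_mult N (mat_adj B) (mat_mult N (mat_mult N (mat_adj A) A) B)"
    by (simp add: mat_adj_mult mat_mult_assoc)
  also have "\<dots> = mat_id N"
    using A B by (simp add: unitary_groupD(3) unitary_id_mult)
  finally have "mat_mult N (mat_adj (mat_mult N A B)) (mat_mult N A B) = mat_id N" .
  moreover have "mat_mult N A B (i,j) = 0" if "N \<le> i \<or> N \<le> j" for i j
    using that unitary_groupD(1,2)[OF A] unitary_groupD(1,2)[OF B] by (auto simp: mat_mult_def)
  ultimately show ?thesis by (simp add: unitary_group_def)
qed

text \<open>A one-sided inverse of a square matrix is two-sided. The fact is imported from the
  matrix type used for determinants; the entries outside the \<open>N\<close> by \<open>N\<close>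
  block are zero on both sides.\<close>

lemma unitary_mult_adj:
  assumes A: "A \<in> unitary_group N"
  shows "mat_mult N A (mat_adj A) = mat_id N"
proof -
  let ?M = "\<lambda>B. Matrix.mat N N B :: complex mat"
  have mult: "?M B * ?M C = ?M (mat_mult N B C)" for B C
    by (rule eq_matI) (auto simp: mat_mult_def scalar_prod_def atLeast0LessThan)
  have one: "?M (mat_id N) = 1\<^sub>m N"
    by (rule eq_matI) (auto simp: mat_id_def)
  have "?M (mat_adj A) * ?M A = 1\<^sub>m N"
    using unitary_groupD(3)[OF A] by (simp add: mult one)
  then have "?M A * ?M (mat_adj A) = 1\<^sub>m N"
    by (rule mat_mult_left_right_inverse[rotated 2]) auto
  then have eq: "?M (mat_mult N A (mat_adj A)) = ?M (mat_id N)"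
    by (simp add: mult one)
  show ?thesis
  proof
    fix p :: "nat \<times> nat"
    obtain i j where p: "p = (i,j)" by force
    show "mat_mult N A (mat_adj A) p = mat_id N p"
    proof (cases "i < N \<and> j < N")
      case True
      then show ?thesis using arg_cong[OF eq, of "\<lambda>M. M $$ (i,j)"] by (simp add: p)
    next
      case False
      then show ?thesis using unitary_groupD(1,2)[OF A]
        by (auto simp: p mat_mult_def mat_adj_def mat_id_def)
    qed
  qed
qed

lemma mat_adj_unitary: 
  assumes A: "A \<in> unitary_group N" 
  shows "mat_adj A \<in> unitary_group N"
proof -
  have "mat_adj A (i,j) = 0" if "N \<le> i \<or> N \<le> j" for i j
    using that unitary_groupD(1,2)[OF A] by (auto simp: mat_adj_def)
  then show ?thesis using unitary_mult_adj[OF A] by (simp add: unitary_group_def)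
qed

lemma mat_vec_eq_0: "A \<in> unitary_group N \<Longrightarrow> N \<le> i \<Longrightarrow> mat_vec N A x i = 0"
  by (simp add: mat_vec_def unitary_groupD(1))

lemma unitary_norm:
  assumes A: "A \<in> unitary_group N"
  shows "(\<Sum>i<N. (cmod (mat_vec N A x i))\<^sup>2) = (\<Sum>i<N. (cmod (x i))\<^sup>2)"
proof -
  have *: "(\<Sum>l<N. cnj (A (l,i)) * A (l,j)) = (if i = j then 1 else 0)" if "i < N" for i j
    using fun_cong[OF unitary_groupD(3)[OF A], of "(i,j)"] that
    by (simp add: mat_mult_def mat_adj_def mat_id_def)
  have "complex_of_real (\<Sum>i<N. (cmod (mat_vec N A x i))\<^sup>2)
      = (\<Sum>l<N. (\<Sum>i<N. cnj (A (l,i)) * cnj (x i)) * (\<Sum>j<N. A (l,j) * x j))"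
    unfolding of_real_sum complex_norm_square
    by (simp add: mat_vec_def mult.commute)
  also have "\<dots> = (\<Sum>l<N. \<Sum>i<N. \<Sum>j<N. cnj (x i) * x j * (cnj (A (l,i)) * A (l,j)))"
    unfolding sum_product by (intro sum.cong refl) (simp add: mult_ac)
  also have "\<dots> = (\<Sum>i<N. \<Sum>j<N. \<Sum>l<N. cnj (x i) * x j * (cnj (A (l,i)) * A (l,j)))"
    by (subst sum.swap, rule sum.cong[OF refl], rule sum.swap)
  also have "\<dots> = (\<Sum>i<N. \<Sum>j<N. cnj (x i) * x j * (if i = j then 1 else 0))"
    by (simp add: sum_distrib_left[symmetric] *)
  also have "\<dots> = (\<Sum>i<N. \<Sum>j<N. if i = j then cnj (x i) * x j else 0)"
    by (intro sum.cong) auto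
  also have "\<dots> = complex_of_real (\<Sum>i<N. (cmod (x i))\<^sup>2)"
    unfolding of_real_sum complex_norm_square by (simp add: mult.commute)
  finally show ?thesis by (simp only: of_real_eq_iff)
qed

lemma mat_vec_sphere: "A \<in> unitary_group N \<Longrightarrow> v \<in> unit_sphere N \<Longrightarrow> mat_vec N A v \<in> unit_sphere N"
  by (simp add: unit_sphere_def unitary_norm mat_vec_eq_0)

lemma mat_extend_unitary:
  assumes W: "W \<in> unitary_group n"
  shows "mat_extend n W \<in> unitary_group (Suc n)"
proof -
  have 1: "(\<Sum>l<n. cnj (W (l,i)) * W (l,j)) = (if i = j \<and> i < n then 1 else 0)" for i j
    using fun_cong[OF unitary_groupD(3)[OF W], of "(i,j)"]
    by (simp add: mat_mult_def mat_adj_def mat_id_def)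
  have "mat_mult (Suc n) (mat_adj (mat_extend n W)) (mat_extend n W) (i,j) = mat_id (Suc n) (i,j)" for i j
    using unitary_groupD(1,2)[OF W] 1[of i j]
    by (auto simp: mat_mult_def mat_adj_def mat_extend_def mat_id_def)
  moreover have "mat_extend n W (i,j) = 0" if "Suc n \<le> i \<or> Suc n \<le> j" for i j
    using that unitary_groupD(1,2)[OF W] by (auto simp: mat_extend_def)
  ultimately show ?thesis by (auto simp: unitary_group_def)
qed

lemma mat_extend_mult:
  assumes V: "V \<in> unitary_group n" and W: "W \<in> unitary_group n"
  shows "mat_mult (Suc n) (mat_extend n V) (mat_extend n W) = mat_extend n (mat_mult n V W)"
proof
  fix p :: "nat \<times> nat"
  obtain i j where p: "p = (i,j)" by force
  show "mat_mult (Suc n) (mat_extend n V) (mat_extend n W) p = mat_extend n (mat_mult n V W) p"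
    using unitary_groupD(1,2)[OF V] unitary_groupD(1,2)[OF W]
    by (cases "i = n"; cases "j = n") (auto simp: p mat_mult_def mat_extend_def)
qed

text \<open>The last column of \<open>g\<close> is the last basis vector, and the other columns are
  orthogonal to it, so the rest of the last row vanishes too.\<close>

lemma stabilizer_eq_extend:
  assumes g: "g \<in> unitary_group (Suc n)" and fix_n: "\<And>i. g (i,n) = (if i = n then 1 else 0)"
  obtains W where "W \<in> unitary_group n" "g = mat_extend n W"
proof
  let ?W = "g((n,n) := 0)"
  have 1: "(\<Sum>l<n. cnj (g (l,i)) * g (l,j)) + cnj (g (n,i)) * g (n,j) = (if i = j \<and> i < Suc n then 1 else 0)" for i j
    using fun_cong[OF unitary_groupD(3)[OF g], of "(i,j)"]
    by (simp add: mat_mult_def mat_adj_def mat_id_def)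
  have row: "g (n,j) = 0" if "j \<noteq> n" for j
    using 1[of n j] that by (simp add: fix_n)
  have out: "?W (i,j) = 0" if "n \<le> i \<or> n \<le> j" for i j
    using that unitary_groupD(1,2)[OF g] row[of j] fix_n[of i]
    by (cases "i = n"; cases "j = n") auto
  have "mat_mult n (mat_adj ?W) ?W (i,j) = mat_id n (i,j)" for i j
  proof (cases "i < n \<and> j < n")
    case True
    then show ?thesis using 1[of i j] row by (simp add: mat_mult_def mat_adj_def mat_id_def)
  next
    case False
    then have "?W (l,i) = 0 \<or> ?W (l,j) = 0" for l
      using out by (meson not_le)
    then have "mat_mult n (mat_adj ?W) ?W (i,j) = 0"
      unfolding mat_mult_def mat_adj_def prod.case
      by (intro sum.neutral) (metis complex_cnj_zero mult_zero_left mult_zero_right)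
    then show ?thesis using False by (auto simp: mat_id_def)
  qed
  then show "?W \<in> unitary_group n" using out by (auto simp: unitary_group_def)
  show "g = mat_extend n ?W" using fix_n[of n] by (auto simp: mat_extend_def)
qed

lemma reflection_eq:
  assumes "u = (\<lambda>i. (if i = n then 1 else 0) - v i)"
  shows "reflection n v (i,j) = mat_id (Suc n) (i,j) - u i * cnj (u j) / cnj (u n)"
  by (simp add: reflection_def assms Let_def)

text \<open>A matrix \<open>I - c u u'\<close> (with \<open>u'\<close> the adjoint of
  \<open>u\<close>) is unitary iff \<open>c + cnj c\<close> equals the squared modulus of
  \<open>c\<close> times that of \<open>u\<close>, for \<open>u\<close> nonzero. For
  \<open>c = 1 / cnj (u n)\<close> this identity is exactly that condition.\<close>

lemma sphere_defect_norm:
  assumes v: "v \<in> unit_sphere (Suc n)" and u: "u = (\<lambda>i. (if i = n then 1 else 0) - v i)"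
  shows "(\<Sum>l<Suc n. cnj (u l) * u l) = u n + cnj (u n)"
proof -
  have s: "(\<Sum>l<n. (cmod (v l))\<^sup>2) + (cmod (v n))\<^sup>2 = 1"
    using v by (simp add: unit_sphere_def)
  have "(\<Sum>l<Suc n. cnj (u l) * u l) = (\<Sum>l<n. complex_of_real ((cmod (v l))\<^sup>2)) + cnj (1 - v n) * (1 - v n)"
    unfolding complex_norm_square by (simp add: u mult.commute)
  also have "\<dots> = complex_of_real ((\<Sum>l<n. (cmod (v l))\<^sup>2) + (cmod (v n))\<^sup>2) + 1 - v n - cnj (v n)"
    unfolding of_real_add complex_norm_square of_real_sum by (simp add: algebra_simps)
  finally show ?thesis unfolding s by (simp add: u)
qed

lemma reflection_unitary:
  assumes v: "v \<in> unit_sphere (Suc n)"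
  shows "reflection n v \<in> unitary_group (Suc n)"
proof -
  define u where u: "u = (\<lambda>i. (if i = n then 1 else 0) - v i)"
  note R = reflection_eq[OF u]
  define d where "d i j = (if i = j then 1 else 0 :: complex)" for i j :: nat
  have d1: "(\<Sum>l<Suc n. d l i * f l) = f i" if "i < Suc n" for i and f :: "nat \<Rightarrow> complex"
  proof -
    have "(\<Sum>l<Suc n. d l i * f l) = (\<Sum>l<Suc n. if l = i then f l else 0)"
      by (rule sum.cong) (auto simp: d_def)
    then show ?thesis using that by simp
  qed
  have out: "u i = 0" if "Suc n \<le> i" for i
    using that v by (auto simp: u unit_sphere_def)
  have out': "reflection n v (i,j) = 0" if "Suc n \<le> i \<or> Suc n \<le> j" for i j
    using that out[of i] out[of j] by (auto simp: R mat_id_def)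
  have "mat_mult (Suc n) (mat_adj (reflection n v)) (reflection n v) (i,j) = mat_id (Suc n) (i,j)" for i j
  proof (cases "i < Suc n \<and> j < Suc n")
    case True
    have "mat_mult (Suc n) (mat_adj (reflection n v)) (reflection n v) (i,j)
       = (\<Sum>l<Suc n. (d l i - cnj (u l) * u i / u n) * (d l j - u l * cnj (u j) / cnj (u n)))"
      unfolding mat_mult_def mat_adj_def prod.case R
      by (rule sum.cong) (auto simp: d_def mat_id_def)
    also have "\<dots> = (\<Sum>l<Suc n. d l i * d l j) - (\<Sum>l<Suc n. d l i * (u l * cnj (u j) / cnj (u n)))
       - (\<Sum>l<Suc n. d l j * (cnj (u l) * u i / u n))
       + (\<Sum>l<Suc n. cnj (u l) * u l) * (u i * cnj (u j) / (u n * cnj (u n)))"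
      unfolding sum_subtractf[symmetric] sum_distrib_right sum.distrib[symmetric]
      by (intro sum.cong refl) (simp add: algebra_simps)
    also have "\<dots> = d i j - u i * cnj (u j) / cnj (u n) - cnj (u j) * u i / u n
       + (u n + cnj (u n)) * (u i * cnj (u j) / (u n * cnj (u n)))"
      using True by (simp only: d1 sphere_defect_norm[OF v u])
    also have "\<dots> = d i j"
    proof -
      have "(a + b) * (x / (a * b)) = x / b + x / a" if "a \<noteq> 0" "b \<noteq> 0" for a b x :: complex
        using that by (simp add: field_simps)
      from this[of "u n" "cnj (u n)" "u i * cnj (u j)"] show ?thesis
        by (cases "u n = 0") (simp_all add: mult.commute)
    qed
    finally show ?thesis using True by (simp add: d_def mat_id_def)
  next
    case False
    then have "reflection n v (l,i) = 0 \<or> reflection n v (l,j) = 0" for l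
      using out' by (meson not_le)
    then have "mat_mult (Suc n) (mat_adj (reflection n v)) (reflection n v) (i,j) = 0"
      unfolding mat_mult_def mat_adj_def prod.case
      by (intro sum.neutral) (metis complex_cnj_zero mult_zero_left mult_zero_right)
    then show ?thesis using False by (auto simp: mat_id_def)
  qed
  with out' show ?thesis by (auto simp: unitary_group_def)
qed

lemma sphere_eq_basis:
  assumes v: "v \<in> unit_sphere (Suc n)" and "v n = 1"
  shows "v = (\<lambda>i. if i = n then 1 else 0)"
proof
  fix i
  have "(\<Sum>i<n. (cmod (v i))\<^sup>2) = 0" using v assms(2) by (simp add: unit_sphere_def)
  then have "\<forall>i<n. v i = 0" by (simp add: sum_nonneg_eq_0_iff)
  moreover have "\<forall>i\<ge>Suc n. v i = 0" using v by (simp add: unit_sphere_def)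
  ultimately show "v i = (if i = n then 1 else 0)"
    using assms(2) by (metis Suc_leI linorder_neqE_nat)
qed

lemma reflection_column:
  assumes v: "v \<in> unit_sphere (Suc n)"
  shows "reflection n v (i,n) = v i"
proof (cases "v n = 1")
  case True
  then show ?thesis by (subst sphere_eq_basis[OF v True])
    (auto simp: reflection_def mat_id_def)
next
  case False
  then have "cnj (1 - v n) \<noteq> 0" by (metis complex_cnj_zero_iff right_minus_eq)
  then show ?thesis by (auto simp: reflection_def mat_id_def)
qed

text \<open>Both \<open>g R(v)\<close> and \<open>R(g v)\<close> send the last basis vector to
  \<open>g v\<close>. Hence the adjoint of \<open>R(g v)\<close> times \<open>g R(v)\<close> fixes
  that vector and lies in the embedded copy of \<open>unitary_group n\<close>.\<close>

lemma mult_reflection: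
  assumes g: "g \<in> unitary_group (Suc n)" and v: "v \<in> unit_sphere (Suc n)"
  obtains W where "W \<in> unitary_group n"
    "mat_mult (Suc n) g (reflection n v) =
     mat_mult (Suc n) (reflection n (mat_vec (Suc n) g v)) (mat_extend n W)"
proof -
  let ?N = "Suc n" and ?w = "mat_vec (Suc n) g v"
  have w: "?w \<in> unit_sphere ?N" by (rule mat_vec_sphere[OF g v])
  let ?R = "reflection n ?w" and ?S = "reflection n v"
  have RU: "?R \<in> unitary_group ?N" "?S \<in> unitary_group ?N"
    by (intro reflection_unitary w v)+
  let ?h = "mat_mult ?N (mat_adj ?R) (mat_mult ?N g ?S)"
  have h: "?h \<in> unitary_group ?N"
    by (intro mat_mult_unitary mat_adj_unitary RU g)
  have col: "mat_mult ?N g ?S (i,n) = ?R (i,n)" for i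
    by (simp only: reflection_column[OF w]) (simp only: mat_mult_def prod.case reflection_column[OF v] mat_vec_def)
  have "?h (i,n) = mat_mult ?N (mat_adj ?R) ?R (i,n)" for i
    unfolding mat_mult_def[of _ "mat_adj ?R"] prod.case col ..
  then have "?h (i,n) = (if i = n then 1 else 0)" for i
    by (simp add: unitary_groupD(3)[OF RU(1)]) (simp add: mat_id_def)
  from stabilizer_eq_extend[OF h this] obtain W where W: "W \<in> unitary_group n" "?h = mat_extend n W"
    by metis
  have "mat_mult ?N ?R ?h = mat_mult ?N (mat_mult ?N ?R (mat_adj ?R)) (mat_mult ?N g ?S)"
    by (simp add: mat_mult_assoc)
  also have "\<dots> = mat_mult ?N g ?S"
    unfolding unitary_mult_adj[OF RU(1)] by (intro unitary_id_mult mat_mult_unitary g RU)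
  finally show ?thesis using W that by metis
qed

text \<open>The last column of \<open>M = I - R(v) D\<close> is \<open>u\<close>, and each other
  column \<open>j\<close> is that of \<open>I - D\<close> plus the multiple \<open>r j\<close> of
  \<open>u\<close>. The column operations that remove these multiples are recorded in the unit lower
  triangular \<open>E\<close>, so \<open>M = P E\<close>; and \<open>P\<close> is block upper
  triangular with diagonal blocks \<open>I - W\<close> and \<open>u n = 1 - v n\<close>.\<close>

lemma charpoly_reflection_extend:
  assumes v: "v \<in> unit_sphere (Suc n)" and W: "W \<in> unitary_group n"
  shows "charpoly_Z (Suc n) (mat_mult (Suc n) (reflection n v) (mat_extend n W)) 0
       = (1 - v n) * charpoly_Z n W 0"
proof -
  let ?N = "Suc n"
  let ?D = "mat_extend n W"
  define u where u: "u = (\<lambda>i. (if i = n then 1 else 0) - v i)"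
  note R = reflection_eq[OF u]
  define r where "r j = (\<Sum>l<?N. cnj (u l) * ?D (l,j)) / cnj (u n)" for j
  define P where "P = Matrix.mat ?N ?N (\<lambda>(i,j). if j = n then u i else (if i = j then 1 else 0) - ?D (i,j))"
  define E where "E = Matrix.mat ?N ?N (\<lambda>(i,j). (if i = j then 1 else 0) + (if i = n \<and> j < n then r j else 0))"
  define M where "M = Matrix.mat ?N ?N (\<lambda>(i,j). (if i = j then 1 else 0)
      - mat_mult ?N (reflection n v) ?D (i,j))"
  have D: "?D \<in> unitary_group ?N" by (rule mat_extend_unitary[OF W])
  have RD: "mat_mult ?N (reflection n v) ?D (i,j) = ?D (i,j) - u i * r j" if "i < ?N" for i j
  proof -
    have "mat_mult ?N (reflection n v) ?D (i,j)
      = mat_mult ?N (mat_id ?N) ?D (i,j) - (\<Sum>l<?N. u i * cnj (u l) / cnj (u n) * ?D (l,j))"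
      unfolding mat_mult_def prod.case R by (simp only: left_diff_distrib sum_subtractf)
    then show ?thesis
      by (simp add: unitary_id_mult[OF D] r_def sum_distrib_left sum_divide_distrib mult_ac del: sum.lessThan_Suc)
  qed
  have col: "?D (i,n) = (if i = n then 1 else 0)" for i
    using unitary_groupD(2)[OF W] by (simp add: mat_extend_def)
  have RDn: "mat_mult ?N (reflection n v) ?D (i,n) = v i" for i
  proof -
    have "mat_mult ?N (reflection n v) ?D (i,n) = (\<Sum>l<?N. if l = n then reflection n v (i,l) else 0)"
      unfolding mat_mult_def prod.case col by (rule sum.cong) auto
    then show ?thesis using reflection_column[OF v] by simp
  qed
  have PE: "(P * E) $$ (i,j) = P $$ (i,j) + (if j < n then u i * r j else 0)" if ij: "i < ?N" "j < ?N" for i j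
  proof -
    have "(P * E) $$ (i,j) = (\<Sum>l<?N. P $$ (i,l) * E $$ (l,j))"
      using ij by (simp add: P_def E_def scalar_prod_def atLeast0LessThan del: sum.lessThan_Suc)
    also have "\<dots> = (\<Sum>l<?N. (if l = j then P $$ (i,l) else 0) + (if l = n then if j < n then P $$ (i,n) * r j else 0 else 0))"
      by (rule sum.cong) (use ij in \<open>auto simp: E_def algebra_simps\<close>)
    also have "\<dots> = P $$ (i,j) + (if j < n then P $$ (i,n) * r j else 0)"
      unfolding sum.distrib using ij by (simp del: sum.lessThan_Suc)
    finally show ?thesis using ij by (auto simp: P_def)
  qed
  have "M = P * E"
  proof (rule eq_matI)
    fix i j assume "i < dim_row (P * E)" "j < dim_col (P * E)"
    then have ij: "i < ?N" "j < ?N" by (simp_all add: P_def E_def)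
    show "M $$ (i,j) = (P * E) $$ (i,j)"
    proof (cases "j = n")
      case True
      then show ?thesis using ij RDn[of i] by (subst PE[OF ij]) (auto simp: M_def P_def u)
    next
      case False
      then show ?thesis using ij RD[of i j] by (subst PE[OF ij]) (auto simp: M_def P_def)
    qed
  qed (auto simp: M_def P_def E_def)
  moreover have "Determinant.det (P * E) = Determinant.det P * Determinant.det E"
    by (rule det_mult) (auto simp: P_def E_def)
  moreover have "Determinant.det E = 1"
  proof (subst det_lower_triangular[of ?N])
    show "prod_list (diag_mat E) = 1"
      unfolding prod_list_diag_prod by (intro prod.neutral) (auto simp: E_def)
  qed (auto simp: E_def)
  moreover have "Determinant.det P = Determinant.det (Matrix.mat n n (\<lambda>(i,j). (if i = j then 1 else 0) - W (i,j))) * u n"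
  proof -
    have "P = four_block_mat (Matrix.mat n n (\<lambda>(i,j). (if i = j then 1 else 0) - W (i,j)))
       (Matrix.mat n 1 (\<lambda>(i,j). u i)) (0\<^sub>m 1 n) (Matrix.mat 1 1 (\<lambda>_. u n))"
      using unitary_groupD(1)[OF W] by (intro eq_matI) (auto simp: P_def mat_extend_def less_Suc_eq)
    then show ?thesis
      by (simp add: det_four_block_mat_lower_left_zero[where n=n and m=1] det_single)
  qed
  moreover have "charpoly_Z ?N (mat_mult ?N (reflection n v) ?D) 0 = Determinant.det M"
    by (simp add: charpoly_Z_def M_def)
  moreover have "charpoly_Z n W 0 = Determinant.det (Matrix.mat n n (\<lambda>(i,j). (if i = j then 1 else 0) - W (i,j)))"
    by (simp add: charpoly_Z_def)
  ultimately show ?thesis by (simp add: u)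
qed

lemma scalar_unitary:
  assumes "cmod c = 1"
  shows "(\<lambda>p. c * mat_id N p) \<in> unitary_group N"
    "U \<in> unitary_group N \<Longrightarrow> mat_mult N (\<lambda>p. c * mat_id N p) U = (\<lambda>p. c * U p)"
proof -
  have 1: "mat_mult N (\<lambda>p. c * A p) B = (\<lambda>p. c * mat_mult N A B p)" for A B
    by (rule ext) (auto simp: mat_mult_def sum_distrib_left mult.assoc)
  have 2: "mat_adj (\<lambda>p. c * A p) = (\<lambda>p. cnj c * mat_adj A p)" for A
    by (rule ext) (auto simp: mat_adj_def)
  have c: "cnj c * c = 1" using assms by (metis complex_norm_square mult.commute of_real_1 one_power2)
  show *: "mat_mult N (\<lambda>p. c * mat_id N p) U = (\<lambda>p. c * U p)" if "U \<in> unitary_group N" for U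
    using that by (simp add: 1 unitary_id_mult)
  have "mat_mult N (\<lambda>p. cnj c * mat_id N p) (\<lambda>p. c * mat_id N p) p = mat_id N p" for p
  proof -
    have "mat_mult N (\<lambda>p. cnj c * mat_id N p) (\<lambda>p. c * mat_id N p) p
        = cnj c * c * mat_mult N (mat_id N) (mat_id N) p"
      by (auto simp: mat_mult_def sum_distrib_left mult_ac split: prod.splits intro!: sum.cong)
    then show ?thesis by (simp add: c unitary_id_mult[OF mat_id_unitary])
  qed
  then show "(\<lambda>p. c * mat_id N p) \<in> unitary_group N"
    by (simp add: unitary_group_def 2 mat_adj_id fun_eq_iff) (simp add: mat_id_def)
qed

text \<open>The phase is absorbed into a unitary scalar matrix, so left invariance of Haar measure
  will reduce every expectation to \<open>\<theta> = 0\<close>.\<close>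

lemma charpoly_Z_rotate:
  assumes "U \<in> unitary_group N"
  shows "charpoly_Z N U \<theta> = charpoly_Z N (mat_mult N (\<lambda>p. exp (- \<i> * complex_of_real \<theta>) * mat_id N p) U) 0"
proof -
  have "cmod (exp (- \<i> * complex_of_real \<theta>)) = 1" by (simp add: norm_exp_eq_Re)
  from scalar_unitary(2)[OF this assms] show ?thesis
    by (simp add: charpoly_Z_def mult.commute)
qed


section \<open>Measurability, left invariance and uniqueness of Haar measure\<close>

abbreviation unitary_space :: "nat \<Rightarrow> (nat \<times> nat \<Rightarrow> complex) measure" where
  "unitary_space N \<equiv> restrict_space borel (unitary_group N)"

abbreviation sphere_space :: "nat \<Rightarrow> (nat \<Rightarrow> complex) measure" where
  "sphere_space N \<equiv> restrict_space borel (unit_sphere N)"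

lemma space_unitary: "sets M = sets (unitary_space N) \<Longrightarrow> space M = unitary_group N"
  by (auto dest: sets_eq_imp_space_eq simp: space_restrict_space)

lemma space_sphere: "sets M = sets (sphere_space N) \<Longrightarrow> space M = unit_sphere N"
  by (auto dest: sets_eq_imp_space_eq simp: space_restrict_space)

lemma measurable_coordinate:
  fixes f :: "'a \<Rightarrow> ('i::countable) \<Rightarrow> complex"
  assumes "f \<in> borel_measurable M"
  shows "(\<lambda>x. f x i) \<in> borel_measurable M"
proof -
  have "(\<lambda>x::'i \<Rightarrow> complex. x i) \<in> borel_measurable borel"
    by (intro borel_measurable_continuous_onI continuous_on_product_coordinates)
  from measurable_compose[OF assms this] show ?thesis .
qed

lemma measurable_mat_mult:
  assumes "f \<in> borel_measurable M" "g \<in> borel_measurable M"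
  shows "(\<lambda>x. mat_mult N (f x) (g x)) \<in> borel_measurable M"
proof (rule measurable_coordinatewise_then_product)
  fix p :: "nat \<times> nat"
  obtain i j where p: "p = (i,j)" by force
  note [measurable] = assms[THEN measurable_coordinate]
  show "(\<lambda>x. mat_mult N (f x) (g x) p) \<in> borel_measurable M"
    unfolding p mat_mult_def prod.case by measurable
qed

lemma measurable_cnj [measurable]: "cnj \<in> borel_measurable borel"
  by (intro borel_measurable_continuous_onI continuous_intros)

lemma measurable_mat_adj:
  assumes "f \<in> borel_measurable M"
  shows "(\<lambda>x. mat_adj (f x)) \<in> borel_measurable M"
proof (rule measurable_coordinatewise_then_product)
  fix p :: "nat \<times> nat"
  obtain i j where p: "p = (i,j)" by force
  note [measurable] = assms[THEN measurable_coordinate]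
  show "(\<lambda>x. mat_adj (f x) p) \<in> borel_measurable M"
    unfolding p mat_adj_def prod.case by measurable
qed

lemma measurable_mat_vec:
  assumes "f \<in> borel_measurable M"
  shows "(\<lambda>x. mat_vec N A (f x)) \<in> borel_measurable M"
proof (rule measurable_coordinatewise_then_product)
  fix i
  note [measurable] = assms[THEN measurable_coordinate]
  show "(\<lambda>x. mat_vec N A (f x) i) \<in> borel_measurable M"
    unfolding mat_vec_def by measurable
qed

lemma measurable_reflection:
  assumes "f \<in> borel_measurable M"
  shows "(\<lambda>x. reflection n (f x)) \<in> borel_measurable M"
proof (rule measurable_coordinatewise_then_product)
  fix p :: "nat \<times> nat"
  obtain i j where p: "p = (i,j)" by force
  note [measurable] = assms[THEN measurable_coordinate]
  show "(\<lambda>x. reflection n (f x) p) \<in> borel_measurable M"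
    unfolding p reflection_def prod.case Let_def by measurable
qed

lemma measurable_mat_extend:
  assumes "f \<in> borel_measurable M"
  shows "(\<lambda>x. mat_extend n (f x)) \<in> borel_measurable M"
proof (rule measurable_coordinatewise_then_product)
  fix p :: "nat \<times> nat"
  note [measurable] = assms[THEN measurable_coordinate]
  show "(\<lambda>x. mat_extend n (f x) p) \<in> borel_measurable M"
    unfolding mat_extend_def by (cases "p = (n,n)") auto
qed

lemma measurable_unitaryI:
  assumes "f \<in> borel_measurable M" "\<And>x. x \<in> space M \<Longrightarrow> f x \<in> unitary_group N" "sets M' = sets (unitary_space N)"
  shows "f \<in> measurable M M'"
proof -
  have "f \<in> measurable M (unitary_space N)"
    using assms by (intro measurable_restrict_space2) auto
  then show ?thesis using measurable_cong_sets[OF refl assms(3)] by blast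
qed

lemma measurable_sphereI:
  assumes "f \<in> borel_measurable M" "\<And>x. x \<in> space M \<Longrightarrow> f x \<in> unit_sphere N" "sets M' = sets (sphere_space N)"
  shows "f \<in> measurable M M'"
proof -
  have "f \<in> measurable M (sphere_space N)"
    using assms by (intro measurable_restrict_space2) auto
  then show ?thesis using measurable_cong_sets[OF refl assms(3)] by blast
qed

lemma measurable_ident_restrict:
  assumes "sets M = sets (restrict_space borel S)"
  shows "(\<lambda>x. x) \<in> borel_measurable M"
proof -
  have "(\<lambda>x. x) \<in> borel_measurable (restrict_space borel S)"
    using measurable_restrict_space1[OF measurable_ident, of borel S] by (simp add: id_def)
  then show ?thesis using measurable_cong_sets[OF assms refl] by blast
qed

lemma nn_integral_distr_target:
  "T \<in> measurable M M' \<Longrightarrow> f \<in> borel_measurable M' \<Longrightarrow> (\<integral>\<^sup>+x. f x \<partial>distr M M' T) = (\<integral>\<^sup>+x. f (T x) \<partial>M)"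
  by (rule nn_integral_distr) auto

text \<open>This is the predicate under the definite description in \<open>haar\<close>, named so
  that existence and uniqueness can be treated separately.\<close>

definition left_invariant_prob :: "nat \<Rightarrow> (nat \<times> nat \<Rightarrow> complex) measure \<Rightarrow> bool" where
  "left_invariant_prob N \<mu> \<longleftrightarrow> sets \<mu> = sets (unitary_space N) \<and> prob_space \<mu> \<and>
      (\<forall>V \<in> unitary_group N. distr \<mu> \<mu> (mat_mult N V) = \<mu>)"

lemma left_invariant_probD:
  assumes "left_invariant_prob N \<mu>"
  shows "sets \<mu> = sets (unitary_space N)" "prob_space \<mu>" "space \<mu> = unitary_group N"
    "V \<in> unitary_group N \<Longrightarrow> mat_mult N V \<in> measurable \<mu> \<mu>"
    "V \<in> unitary_group N \<Longrightarrow> f \<in> borel_measurable \<mu> \<Longrightarrow>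
       (\<integral>\<^sup>+y. f (mat_mult N V y) \<partial>\<mu>) = (\<integral>\<^sup>+y. f y \<partial>\<mu>)"
proof -
  show s: "sets \<mu> = sets (unitary_space N)" and "prob_space \<mu>"
    using assms by (auto simp: left_invariant_prob_def)
  then show sp: "space \<mu> = unitary_group N" by (intro space_unitary)
  show m: "mat_mult N V \<in> measurable \<mu> \<mu>" if "V \<in> unitary_group N" for V
    using that by (intro measurable_unitaryI[OF _ _ s] measurable_mat_mult measurable_ident_restrict[OF s])
      (auto simp: sp intro: mat_mult_unitary)
  show "(\<integral>\<^sup>+y. f (mat_mult N V y) \<partial>\<mu>) = (\<integral>\<^sup>+y. f y \<partial>\<mu>)"
    if "V \<in> unitary_group N" "f \<in> borel_measurable \<mu>" for V f
  proof -
    have "(\<integral>\<^sup>+y. f y \<partial>\<mu>) = (\<integral>\<^sup>+y. f y \<partial>distr \<mu> \<mu> (mat_mult N V))"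
      using assms that by (simp add: left_invariant_prob_def)
    also have "\<dots> = (\<integral>\<^sup>+y. f (mat_mult N V y) \<partial>\<mu>)"
      by (rule nn_integral_distr_target[OF m[OF that(1)] that(2)])
    finally show ?thesis ..
  qed
qed

text \<open>Integrating \<open>x\<inverse> y\<close> over \<open>\<nu> \<times> \<mu>\<close> in both orders shows that \<open>\<mu>\<close> is the image of \<open>\<nu>\<close> under
  inversion; applying this to \<open>(\<mu>, \<nu>)\<close> and \<open>(\<nu>, \<nu>)\<close> gives uniqueness.\<close>

lemma left_invariant_prob_inversion:
  assumes mu: "left_invariant_prob N \<mu>" and nu: "left_invariant_prob N \<nu>" and A: "A \<in> sets (unitary_space N)"
  shows "emeasure \<mu> A = (\<integral>\<^sup>+x. indicator A (mat_adj x) \<partial>\<nu>)"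
proof -
  interpret M: prob_space \<mu> by (rule left_invariant_probD[OF mu])
  interpret N: prob_space \<nu> by (rule left_invariant_probD[OF nu])
  interpret P: pair_sigma_finite \<mu> \<nu> ..
  note smu = left_invariant_probD(1)[OF mu] and snu = left_invariant_probD(1)[OF nu]
  note spmu = left_invariant_probD(3)[OF mu] and spnu = left_invariant_probD(3)[OF nu]
  have Amu: "A \<in> sets \<mu>" using A smu by simp
  have meas: "(\<lambda>(y,x). mat_mult N (mat_adj x) y) \<in> measurable (\<mu> \<Otimes>\<^sub>M \<nu>) \<mu>"
  proof (rule measurable_unitaryI[OF _ _ smu])
    have 1: "fst \<in> borel_measurable (\<mu> \<Otimes>\<^sub>M \<nu>)" "snd \<in> borel_measurable (\<mu> \<Otimes>\<^sub>M \<nu>)"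
      using measurable_compose[OF measurable_fst measurable_ident_restrict[OF smu]]
        measurable_compose[OF measurable_snd measurable_ident_restrict[OF snu]] by auto
    show "(\<lambda>(y,x). mat_mult N (mat_adj x) y) \<in> borel_measurable (\<mu> \<Otimes>\<^sub>M \<nu>)"
      unfolding case_prod_beta by (intro measurable_mat_mult measurable_mat_adj 1)
  qed (auto simp: space_pair_measure spmu spnu intro: mat_mult_unitary mat_adj_unitary)
  let ?f = "\<lambda>p. indicator A (case p of (y,x) \<Rightarrow> mat_mult N (mat_adj x) y) :: ennreal"
  have f: "?f \<in> borel_measurable (\<mu> \<Otimes>\<^sub>M \<nu>)"
    by (rule measurable_compose[OF meas borel_measurable_indicator[OF Amu]])
  have "emeasure \<mu> A = (\<integral>\<^sup>+x. emeasure \<mu> A \<partial>\<nu>)"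
    by (simp add: N.emeasure_space_1)
  also have "\<dots> = (\<integral>\<^sup>+x. (\<integral>\<^sup>+y. ?f (y,x) \<partial>\<mu>) \<partial>\<nu>)"
  proof (rule nn_integral_cong)
    fix x assume "x \<in> space \<nu>"
    then have "mat_adj x \<in> unitary_group N" by (simp add: spnu mat_adj_unitary)
    then have "(\<integral>\<^sup>+y. indicator A (mat_mult N (mat_adj x) y) \<partial>\<mu>) = (\<integral>\<^sup>+y. indicator A y \<partial>\<mu>)"
      by (rule left_invariant_probD[OF mu]) (rule borel_measurable_indicator[OF Amu])
    then show "emeasure \<mu> A = (\<integral>\<^sup>+y. ?f (y,x) \<partial>\<mu>)"
      using Amu by simp
  qed
  also have "\<dots> = (\<integral>\<^sup>+y. (\<integral>\<^sup>+x. ?f (y,x) \<partial>\<nu>) \<partial>\<mu>)"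
    by (rule P.Fubini[OF f])
  also have "\<dots> = (\<integral>\<^sup>+y. (\<integral>\<^sup>+x. indicator A (mat_adj x) \<partial>\<nu>) \<partial>\<mu>)"
  proof (rule nn_integral_cong)
    fix y assume "y \<in> space \<mu>"
    then have y: "mat_adj y \<in> unitary_group N" by (simp add: spmu mat_adj_unitary)
    have "mat_adj \<in> measurable \<nu> \<mu>"
      by (rule measurable_unitaryI[OF measurable_mat_adj[OF measurable_ident_restrict[OF snu]] _ smu])
        (simp add: spnu mat_adj_unitary)
    from measurable_compose[OF this borel_measurable_indicator[OF Amu]]
    have "(\<lambda>x. indicator A (mat_adj x) :: ennreal) \<in> borel_measurable \<nu>" .
    \<comment> \<open>The inverse of \<open>x\<close> times \<open>y\<close> is the inverse of
      (inverse of \<open>y\<close>, times \<open>x\<close>). The \<open>x\<close>-integral is thus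
      one of a function of a left translate of \<open>x\<close>, and invariance of
      \<open>\<nu>\<close> makes it independent of \<open>y\<close>.\<close>
    from left_invariant_probD(5)[OF nu y this]
    show "(\<integral>\<^sup>+x. ?f (y,x) \<partial>\<nu>) = (\<integral>\<^sup>+x. indicator A (mat_adj x) \<partial>\<nu>)"
      by (simp add: mat_adj_mult)
  qed
  also have "\<dots> = (\<integral>\<^sup>+x. indicator A (mat_adj x) \<partial>\<nu>)"
    by (simp add: M.emeasure_space_1)
  finally show ?thesis .
qed

lemma left_invariant_prob_unique:
  assumes "left_invariant_prob N \<mu>" "left_invariant_prob N \<nu>"
  shows "\<mu> = \<nu>"
proof (rule measure_eqI)
  show "sets \<mu> = sets \<nu>" using assms left_invariant_probD(1) by metis
  fix A assume "A \<in> sets \<mu>"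
  then have "A \<in> sets (unitary_space N)" using left_invariant_probD(1)[OF assms(1)] by simp
  then show "emeasure \<mu> A = emeasure \<nu> A"
    using left_invariant_prob_inversion[OF assms] left_invariant_prob_inversion[OF assms(2,2)] by metis
qed

lemma haar_eqI: "left_invariant_prob N \<mu> \<Longrightarrow> haar N = \<mu>"
  unfolding haar_def
  by (rule the_equality) (auto simp: left_invariant_prob_def[symmetric] intro: left_invariant_prob_unique)

subsection \<open>The invariant probability measure on the sphere\<close>

text \<open>Points of this product space are \<open>undefined\<close> from index \<open>N\<close>
  on, whereas vectors of \<open>unit_sphere N\<close> are 0 there. Hence the restrictions to
  \<open>{..<N}\<close> below and the explicit 0 in \<open>normalize_vec\<close>.\<close>

definition lebesgue_vec :: "nat \<Rightarrow> (nat \<Rightarrow> complex) measure" where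
  "lebesgue_vec N = Pi\<^sub>M {..<N} (\<lambda>_. lborel)"

interpretation lebesgue_vec_product: product_sigma_finite "\<lambda>_::nat. lborel :: complex measure" ..

lemma sigma_finite_lebesgue_vec: "sigma_finite_measure (lebesgue_vec N)"
  unfolding lebesgue_vec_def by (rule lebesgue_vec_product.sigma_finite) simp

lemma space_lebesgue_vec: "space (lebesgue_vec N) = {..<N} \<rightarrow>\<^sub>E UNIV"
  by (simp add: lebesgue_vec_def space_PiM)

lemma measurable_lebesgue_vec_component [measurable]:
  "i < N \<Longrightarrow> (\<lambda>x. x i) \<in> borel_measurable (lebesgue_vec N)"
proof -
  assume "i < N"
  then have "(\<lambda>x. x i) \<in> measurable (lebesgue_vec N) (lborel :: complex measure)"
    unfolding lebesgue_vec_def by (intro measurable_component_singleton) simp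
  then show ?thesis by simp
qed

lemma measurable_lebesgue_vecI:
  assumes "\<And>i. i < N \<Longrightarrow> (\<lambda>x. f x i) \<in> borel_measurable M"
  shows "(\<lambda>x. \<lambda>i\<in>{..<N}. f x i) \<in> measurable M (lebesgue_vec N)"
  unfolding lebesgue_vec_def using assms by (intro measurable_restrict) auto

lemma measurable_mat_vec_lebesgue:
  "(\<lambda>x. mat_vec N A x i) \<in> borel_measurable (lebesgue_vec N)"
  unfolding mat_vec_def by (intro borel_measurable_sum borel_measurable_times) auto

lemma measurable_norm_lebesgue [measurable]:
  "(\<lambda>x. \<Sum>i<N. (cmod (x i))\<^sup>2) \<in> borel_measurable (lebesgue_vec N)"
  by (intro borel_measurable_sum borel_measurable_power borel_measurable_norm) auto

lemma lebesgue_vec_translate: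
  "distr (lebesgue_vec N) (lebesgue_vec N) (\<lambda>x. \<lambda>i\<in>{..<N}. x i + a i) = lebesgue_vec N"
  (is "?D = _")
proof -
  have meas: "(\<lambda>x. \<lambda>i\<in>{..<N}. x i + a i) \<in> measurable (lebesgue_vec N) (lebesgue_vec N)"
    by (rule measurable_lebesgue_vecI) measurable
  have "?D = Pi\<^sub>M {..<N} (\<lambda>_. lborel)"
  proof (rule lebesgue_vec_product.PiM_eqI)
    fix A :: "nat \<Rightarrow> complex set" assume A: "\<And>i. i \<in> {..<N} \<Longrightarrow> A i \<in> sets lborel"
    have pre: "(\<lambda>z. z + a i) -` A i \<in> sets lborel" if "i \<in> {..<N}" for i
    proof -
      have "(\<lambda>z. z + a i) \<in> measurable borel borel" by measurable
      from measurable_sets[OF this, of "A i"] A[OF that] show ?thesis by simp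
    qed
    have tr: "emeasure lborel ((\<lambda>z. z + a i) -` A i) = emeasure lborel (A i)" if "i \<in> {..<N}" for i
    proof -
      have "emeasure lborel (A i) = emeasure (distr lborel borel ((+) (a i))) (A i)"
        by (simp add: lborel_distr_plus)
      also have "\<dots> = emeasure lborel ((+) (a i) -` A i)"
        using A[OF that] by (subst emeasure_distr) auto
      finally show ?thesis by (simp add: add.commute[of _ "a i"])
    qed
    have "emeasure ?D (Pi\<^sub>E {..<N} A) = emeasure (lebesgue_vec N)
        ((\<lambda>x. \<lambda>i\<in>{..<N}. x i + a i) -` (Pi\<^sub>E {..<N} A) \<inter> space (lebesgue_vec N))"
      by (rule emeasure_distr[OF meas])
        (use A in \<open>auto simp: lebesgue_vec_def intro!: sets_PiM_I_finite\<close>)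
    also have "(\<lambda>x. \<lambda>i\<in>{..<N}. x i + a i) -` (Pi\<^sub>E {..<N} A) \<inter> space (lebesgue_vec N)
        = Pi\<^sub>E {..<N} (\<lambda>i. (\<lambda>z. z + a i) -` A i)"
      by (auto simp: space_lebesgue_vec PiE_iff)
    also have "emeasure (lebesgue_vec N) \<dots> = (\<Prod>i<N. emeasure lborel ((\<lambda>z. z + a i) -` A i))"
      unfolding lebesgue_vec_def by (rule lebesgue_vec_product.emeasure_PiM) (use pre in auto)
    also have "\<dots> = (\<Prod>i<N. emeasure lborel (A i))"
      by (rule prod.cong) (use tr in auto)
    finally show "emeasure ?D (Pi\<^sub>E {..<N} A) = (\<Prod>i\<in>{..<N}. emeasure lborel (A i))" .
  qed (auto simp: lebesgue_vec_def)
  then show ?thesis by (simp add: lebesgue_vec_def)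
qed

lemma nn_integral_translate:
  assumes "f \<in> borel_measurable (lebesgue_vec N)"
  shows "(\<integral>\<^sup>+x. f (\<lambda>i\<in>{..<N}. x i + a i) \<partial>lebesgue_vec N) = (\<integral>\<^sup>+x. f x \<partial>lebesgue_vec N)"
proof -
  have meas: "(\<lambda>x. \<lambda>i\<in>{..<N}. x i + a i) \<in> measurable (lebesgue_vec N) (lebesgue_vec N)"
    by (rule measurable_lebesgue_vecI) measurable
  from nn_integral_distr_target[OF this assms] show ?thesis by (simp add: lebesgue_vec_translate)
qed

text \<open>A set that unitary maps preserve, of positive finite measure, on which division by the
  norm is legitimate.\<close>

definition punctured_ball :: "nat \<Rightarrow> (nat \<Rightarrow> complex) set" where
  "punctured_ball N = {x \<in> space (lebesgue_vec N). 0 < (\<Sum>i<N. (cmod (x i))\<^sup>2) \<and> (\<Sum>i<N. (cmod (x i))\<^sup>2) \<le> 1}"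

lemma sets_punctured_ball [measurable]: "punctured_ball N \<in> sets (lebesgue_vec N)"
  unfolding punctured_ball_def by measurable

text \<open>The set lies between two products of discs. The inner radius \<open>1 / N\<close> works
  because the squared norm is then at most \<open>N * (1 / N)^2 = 1 / N\<close>; the inner discs
  omit 0 to keep that norm positive.\<close>

lemma emeasure_punctured_ball:
  assumes N: "N > 0"
  shows "emeasure (lebesgue_vec N) (punctured_ball N) > 0" "emeasure (lebesgue_vec N) (punctured_ball N) < \<infinity>"
proof -
  let ?C = "cball 0 (1 / real N) - {0} :: complex set"
  have sub1: "Pi\<^sub>E {..<N} (\<lambda>_. ?C) \<subseteq> punctured_ball N"
  proof
    fix x assume x: "x \<in> Pi\<^sub>E {..<N} (\<lambda>_. ?C)"
    then have xi: "x i \<noteq> 0" "cmod (x i) \<le> 1 / real N" if "i < N" for i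
      using that by (auto simp: PiE_iff)
    have "(\<Sum>i<N. (cmod (x i))\<^sup>2) \<le> (\<Sum>i<N. (1 / real N)\<^sup>2)"
      by (intro sum_mono power_mono xi) auto
    also have "\<dots> = 1 / real N" using N by (simp add: power2_eq_square)
    also have "\<dots> \<le> 1" using N by simp
    finally have "(\<Sum>i<N. (cmod (x i))\<^sup>2) \<le> 1" .
    moreover have "0 < (\<Sum>i<N. (cmod (x i))\<^sup>2)"
      using N xi by (intro sum_pos) auto
    ultimately show "x \<in> punctured_ball N"
      using x by (auto simp: punctured_ball_def space_lebesgue_vec PiE_iff)
  qed
  have "emeasure lborel ?C = emeasure lborel (cball 0 (1 / real N) :: complex set)"
    by (rule emeasure_Diff_null_set) (auto simp: null_sets_def)
  also have "\<dots> > 0"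
  proof -
    have "emeasure lborel (cball 0 (1 / real N) :: complex set)
        = ennreal (unit_ball_vol (real DIM(complex)) * (1 / real N) ^ DIM(complex))"
      by (rule emeasure_cball) simp
    also have "\<dots> > 0" using N by simp
    finally show ?thesis .
  qed
  finally have C: "0 < emeasure lborel ?C" .
  have "emeasure (lebesgue_vec N) (Pi\<^sub>E {..<N} (\<lambda>_. ?C)) = (\<Prod>i<N. emeasure lborel ?C)"
    unfolding lebesgue_vec_def by (rule lebesgue_vec_product.emeasure_PiM) auto
  also have "\<dots> > 0"
  proof -
    have "0 < c ^ N" if "0 < c" for c :: ennreal
      using that by (induction N) (auto simp: ennreal_zero_less_mult_iff)
    then show ?thesis using C by simp
  qed
  finally show "emeasure (lebesgue_vec N) (punctured_ball N) > 0"
    using emeasure_mono[OF sub1 sets_punctured_ball] by (rule less_le_trans)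
  let ?K = "cball 0 1 :: complex set"
  have sub2: "punctured_ball N \<subseteq> Pi\<^sub>E {..<N} (\<lambda>_. ?K)"
  proof
    fix x assume x: "x \<in> punctured_ball N"
    have "cmod (x i) \<le> 1" if "i < N" for i
    proof -
      have "(cmod (x i))\<^sup>2 \<le> (\<Sum>i<N. (cmod (x i))\<^sup>2)"
        using that by (intro member_le_sum) auto
      also have "\<dots> \<le> 1" using x by (simp add: punctured_ball_def)
      finally show ?thesis using power2_le_imp_le[of "cmod (x i)" 1] by simp
    qed
    then show "x \<in> Pi\<^sub>E {..<N} (\<lambda>_. ?K)"
      using x by (auto simp: punctured_ball_def space_lebesgue_vec PiE_iff)
  qed
  have "emeasure (lebesgue_vec N) (punctured_ball N) \<le> emeasure (lebesgue_vec N) (Pi\<^sub>E {..<N} (\<lambda>_. ?K))"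
    by (intro emeasure_mono sub2) (auto simp: lebesgue_vec_def intro!: sets_PiM_I_finite)
  also have "\<dots> = (\<Prod>i<N. emeasure lborel ?K)"
    unfolding lebesgue_vec_def by (rule lebesgue_vec_product.emeasure_PiM) auto
  also have "\<dots> < \<infinity>"
    using emeasure_bounded_finite[of ?K] by (simp add: power_less_top_ennreal)
  finally show "emeasure (lebesgue_vec N) (punctured_ball N) < \<infinity>" .
qed

lemma mat_vec_restrict: "mat_vec N A (\<lambda>i\<in>{..<N}. f i) = mat_vec N A f"
  by (auto simp: mat_vec_def)

lemma mat_vec_add: "mat_vec N A (\<lambda>i. x i + y i) i = mat_vec N A x i + mat_vec N A y i"
  by (simp add: mat_vec_def distrib_left sum.distrib)

lemma mat_vec_adj_cancel:
  assumes "A \<in> unitary_group N" "i < N"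
  shows "mat_vec N A (mat_vec N (mat_adj A) y) i = y i"
proof -
  have "mat_vec N A (mat_vec N (mat_adj A) y) i = mat_vec N (mat_id N) y i"
    by (simp add: mat_vec_mat_mult[symmetric] unitary_mult_adj[OF assms(1)])
  also have "\<dots> = (\<Sum>l<N. if l = i then y l else 0)"
    unfolding mat_vec_def by (rule sum.cong) (use assms(2) in \<open>auto simp: mat_id_def\<close>)
  finally show ?thesis using assms(2) by simp
qed

text \<open>Translation invariance alone identifies the image of Lebesgue measure under a linear
  bijection up to a constant factor, and the unit ball, which a unitary map preserves,
  shows that the factor is \<open>1\<close>. The two steps are carried out at once by evaluating
  \<open>\<integral>\<integral> f (g x) b(y) dx dy\<close>, where \<open>b\<close> is the indicator of the ball, with three translations.\<close>

lemma lebesgue_vec_unitary: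
  assumes g: "g \<in> unitary_group N" and N: "N > 0" and f: "f \<in> borel_measurable (lebesgue_vec N)"
  shows "(\<integral>\<^sup>+x. f (\<lambda>i\<in>{..<N}. mat_vec N g x i) \<partial>lebesgue_vec N) = (\<integral>\<^sup>+x. f x \<partial>lebesgue_vec N)"
proof -
  let ?L = "lebesgue_vec N"
  let ?r = "\<lambda>f. (\<lambda>i\<in>{..<N}. f i) :: nat \<Rightarrow> complex"
  interpret L: sigma_finite_measure ?L by (rule sigma_finite_lebesgue_vec)
  interpret P: pair_sigma_finite ?L ?L ..
  let ?b = "indicator (punctured_ball N) :: _ \<Rightarrow> ennreal"
  have b_eq: "?b x = ?b y" if "x \<in> space ?L" "y \<in> space ?L" "(\<Sum>i<N. (cmod (x i))\<^sup>2) = (\<Sum>i<N. (cmod (y i))\<^sup>2)" for x y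
    using that by (simp add: punctured_ball_def indicator_def)
  have b: "?b \<in> borel_measurable ?L" by simp
  have rsp: "?r h \<in> space ?L" for h by (simp add: space_lebesgue_vec)
  have mg: "(\<lambda>x. ?r (mat_vec N g x)) \<in> measurable ?L ?L"
    by (intro measurable_lebesgue_vecI measurable_mat_vec_lebesgue)
  have gf: "(\<lambda>x. f (?r (mat_vec N g x))) \<in> borel_measurable ?L"
    by (rule measurable_compose[OF mg f])
  have g_translate: "mat_vec N g (?r (\<lambda>i. x i + mat_vec N (mat_adj g) y i)) i = mat_vec N g x i + y i"
    if "i < N" for x y i
    using that g by (simp add: mat_vec_restrict mat_vec_add mat_vec_adj_cancel)
  have m1: "(\<lambda>(x,y). ?r (\<lambda>i. mat_vec N g x i + y i)) \<in> measurable (?L \<Otimes>\<^sub>M ?L) ?L"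
    unfolding case_prod_beta
    by (intro measurable_lebesgue_vecI borel_measurable_add)
      (auto intro: measurable_compose[OF measurable_fst measurable_mat_vec_lebesgue]
        measurable_compose[OF measurable_snd measurable_lebesgue_vec_component])
  have m2: "(\<lambda>(x,y). ?r (\<lambda>i. y i - mat_vec N g x i)) \<in> measurable (?L \<Otimes>\<^sub>M ?L) ?L"
    unfolding case_prod_beta
    by (intro measurable_lebesgue_vecI borel_measurable_diff)
      (auto intro: measurable_compose[OF measurable_fst measurable_mat_vec_lebesgue]
        measurable_compose[OF measurable_snd measurable_lebesgue_vec_component])
  have f1: "(\<lambda>(x,y). f (?r (\<lambda>i. mat_vec N g x i + y i)) * ?b y) \<in> borel_measurable (?L \<Otimes>\<^sub>M ?L)"
    using borel_measurable_times_ennreal[OF measurable_compose[OF m1 f] measurable_compose[OF measurable_snd b]]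
    by (simp add: case_prod_beta)
  have f2: "(\<lambda>(x,y). f y * ?b (?r (\<lambda>i. y i - mat_vec N g x i))) \<in> borel_measurable (?L \<Otimes>\<^sub>M ?L)"
    using borel_measurable_times_ennreal[OF measurable_compose[OF measurable_snd f] measurable_compose[OF m2 b]]
    by (simp add: case_prod_beta)
  have "(\<integral>\<^sup>+x. f (?r (mat_vec N g x)) \<partial>?L) * (\<integral>\<^sup>+y. ?b y \<partial>?L)
      = (\<integral>\<^sup>+y. (\<integral>\<^sup>+x. f (?r (mat_vec N g x)) \<partial>?L) * ?b y \<partial>?L)"
    by (rule nn_integral_cmult[symmetric]) simp
  \<comment> \<open>First translation, for fixed \<open>y\<close>: shifting \<open>x\<close> by the
    inverse of \<open>g\<close> applied to \<open>y\<close> turns \<open>g x\<close> into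
    \<open>g x + y\<close>.\<close>
  also have "\<dots> = (\<integral>\<^sup>+y. (\<integral>\<^sup>+x. f (?r (\<lambda>i. mat_vec N g x i + y i)) * ?b y \<partial>?L) \<partial>?L)"
  proof (rule nn_integral_cong)
    fix y assume "y \<in> space ?L"
    have "(\<integral>\<^sup>+x. f (?r (mat_vec N g x)) \<partial>?L)
        = (\<integral>\<^sup>+x. f (?r (mat_vec N g (?r (\<lambda>i. x i + mat_vec N (mat_adj g) y i)))) \<partial>?L)"
      by (rule nn_integral_translate[OF gf, symmetric])
    also have "\<dots> = (\<integral>\<^sup>+x. f (?r (\<lambda>i. mat_vec N g x i + y i)) \<partial>?L)"
      by (rule nn_integral_cong, rule arg_cong[where f=f]) (intro restrict_ext, simp only: lessThan_iff g_translate)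
    finally show "(\<integral>\<^sup>+x. f (?r (mat_vec N g x)) \<partial>?L) * ?b y
        = (\<integral>\<^sup>+x. f (?r (\<lambda>i. mat_vec N g x i + y i)) * ?b y \<partial>?L)"
      by (cases "y \<in> punctured_ball N") auto
  qed
  also have "\<dots> = (\<integral>\<^sup>+x. (\<integral>\<^sup>+y. f (?r (\<lambda>i. mat_vec N g x i + y i)) * ?b y \<partial>?L) \<partial>?L)"
    using P.Fubini[OF f1] by simp
  \<comment> \<open>Second translation, for fixed \<open>x\<close>: shifting \<open>y\<close> by
    \<open>g x\<close> moves the dependence on \<open>x\<close> from \<open>f\<close> to the ball
    indicator.\<close>
  also have "\<dots> = (\<integral>\<^sup>+x. (\<integral>\<^sup>+y. f y * ?b (?r (\<lambda>i. y i - mat_vec N g x i)) \<partial>?L) \<partial>?L)"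
  proof (rule nn_integral_cong)
    fix x assume x: "x \<in> space ?L"
    have "(\<lambda>y. f y * ?b (?r (\<lambda>i. y i - mat_vec N g x i))) \<in> borel_measurable ?L"
      using measurable_compose[OF measurable_Pair1'[OF x, of ?L] f2] by simp
    from nn_integral_translate[OF this, of "mat_vec N g x"]
    have "(\<integral>\<^sup>+y. f y * ?b (?r (\<lambda>i. y i - mat_vec N g x i)) \<partial>?L)
      = (\<integral>\<^sup>+y. f (?r (\<lambda>i. y i + mat_vec N g x i)) * ?b (?r (\<lambda>i. ?r (\<lambda>i. y i + mat_vec N g x i) i - mat_vec N g x i)) \<partial>?L)"
      by simp
    also have "\<dots> = (\<integral>\<^sup>+y. f (?r (\<lambda>i. mat_vec N g x i + y i)) * ?b y \<partial>?L)"
      by (intro nn_integral_cong arg_cong2[where f="(*)"] b_eq rsp) (auto simp: add.commute)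
    finally show "(\<integral>\<^sup>+y. f (?r (\<lambda>i. mat_vec N g x i + y i)) * ?b y \<partial>?L)
      = (\<integral>\<^sup>+y. f y * ?b (?r (\<lambda>i. y i - mat_vec N g x i)) \<partial>?L)" ..
  qed
  also have "\<dots> = (\<integral>\<^sup>+y. (\<integral>\<^sup>+x. f y * ?b (?r (\<lambda>i. y i - mat_vec N g x i)) \<partial>?L) \<partial>?L)"
    using P.Fubini[OF f2] by simp
  \<comment> \<open>Third translation, the shift of the first one again: \<open>y - g x\<close>
    becomes \<open>- g x\<close>, which has the same norm as \<open>x\<close>, so the indicator no
    longer sees \<open>g\<close> or \<open>y\<close>.\<close>
  also have "\<dots> = (\<integral>\<^sup>+y. f y * (\<integral>\<^sup>+x. ?b x \<partial>?L) \<partial>?L)"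
  proof (rule nn_integral_cong)
    fix y assume y: "y \<in> space ?L"
    have bm: "(\<lambda>x. ?b (?r (\<lambda>i. y i - mat_vec N g x i))) \<in> borel_measurable ?L"
      using measurable_compose[OF measurable_compose[OF measurable_Pair2'[OF y, of ?L] m2] b] by simp
    have "(\<integral>\<^sup>+x. ?b (?r (\<lambda>i. y i - mat_vec N g x i)) \<partial>?L)
      = (\<integral>\<^sup>+x. ?b (?r (\<lambda>i. y i - mat_vec N g (?r (\<lambda>i. x i + mat_vec N (mat_adj g) y i)) i)) \<partial>?L)"
      by (rule nn_integral_translate[OF bm, symmetric])
    also have "\<dots> = (\<integral>\<^sup>+x. ?b x \<partial>?L)"
    proof (rule nn_integral_cong)
      fix x assume "x \<in> space ?L"
      show "?b (?r (\<lambda>i. y i - mat_vec N g (?r (\<lambda>i. x i + mat_vec N (mat_adj g) y i)) i)) = ?b x"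
        by (rule b_eq[OF rsp \<open>x \<in> space ?L\<close>]) (simp add: g_translate unitary_norm[OF g])
    qed
    finally show "(\<integral>\<^sup>+x. f y * ?b (?r (\<lambda>i. y i - mat_vec N g x i)) \<partial>?L) = f y * (\<integral>\<^sup>+x. ?b x \<partial>?L)"
      using nn_integral_cmult[OF bm, of "f y"] by simp
  qed
  also have "\<dots> = (\<integral>\<^sup>+y. f y \<partial>?L) * (\<integral>\<^sup>+x. ?b x \<partial>?L)"
    by (rule nn_integral_multc[OF f])
  \<comment> \<open>The common factor, the measure of the ball, is neither 0 nor infinite and can be
    cancelled.\<close>
  finally show ?thesis
    using emeasure_punctured_ball[OF N]
    by (simp add: mult.commute[of _ "emeasure ?L (punctured_ball N)"] ennreal_mult_cancel_left) auto
qed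

text \<open>The default vector at norm 0 keeps the map inside the sphere everywhere (for
  \<open>N > 0\<close>), so it is a measurable map into \<open>sphere_space N\<close> without
  exceptions.\<close>

definition normalize_vec :: "nat \<Rightarrow> (nat \<Rightarrow> complex) \<Rightarrow> nat \<Rightarrow> complex" where
  "normalize_vec N x = (if (\<Sum>i<N. (cmod (x i))\<^sup>2) = 0 then (\<lambda>i. if i = 0 then 1 else 0)
     else (\<lambda>i. if i < N then x i / complex_of_real (sqrt (\<Sum>i<N. (cmod (x i))\<^sup>2)) else 0))"

definition sphere_law :: "nat \<Rightarrow> (nat \<Rightarrow> complex) measure" where
  "sphere_law N = distr (uniform_measure (lebesgue_vec N) (punctured_ball N)) (sphere_space N) (normalize_vec N)"

lemma sets_sphere_law: "sets (sphere_law N) = sets (sphere_space N)"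
  by (simp add: sphere_law_def)

lemma space_sphere_law: "space (sphere_law N) = unit_sphere N"
  by (simp add: space_sphere[OF sets_sphere_law])

lemma normalize_vec_sphere:
  assumes "N > 0"
  shows "normalize_vec N x \<in> unit_sphere N"
proof (cases "(\<Sum>i<N. (cmod (x i))\<^sup>2) = 0")
  case True
  have "(\<Sum>i<N. (cmod (if i = 0 then 1 else 0))\<^sup>2) = (\<Sum>i<N. if i = 0 then 1 else (0::real))"
    by (rule sum.cong) auto
  then show ?thesis using True assms by (auto simp: normalize_vec_def unit_sphere_def)
next
  case False
  let ?s = "\<Sum>i<N. (cmod (x i))\<^sup>2"
  have "?s \<ge> 0" by (intro sum_nonneg) auto
  then have "(\<Sum>i<N. (cmod (x i / complex_of_real (sqrt ?s)))\<^sup>2) = (\<Sum>i<N. (cmod (x i))\<^sup>2 / ?s)"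
    by (simp add: norm_divide power_divide)
  also have "\<dots> = 1" using False by (simp add: sum_divide_distrib[symmetric])
  finally show ?thesis using False by (simp add: normalize_vec_def unit_sphere_def)
qed

lemma measurable_normalize_vec:
  assumes "N > 0"
  shows "normalize_vec N \<in> measurable (lebesgue_vec N) (sphere_space N)"
proof (rule measurable_sphereI[OF measurable_coordinatewise_then_product _ refl])
  fix i
  show "(\<lambda>x. normalize_vec N x i) \<in> borel_measurable (lebesgue_vec N)"
  proof (cases "i < N")
    case True
    then have [measurable]: "(\<lambda>x. x i) \<in> borel_measurable (lebesgue_vec N)" by measurable
    have "(\<lambda>x. normalize_vec N x i) = (\<lambda>x. if (\<Sum>i<N. (cmod (x i))\<^sup>2) = 0 then (if i = 0 then 1 else 0)
       else x i / complex_of_real (sqrt (\<Sum>i<N. (cmod (x i))\<^sup>2)))"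
      using True by (auto simp: normalize_vec_def)
    also have "\<dots> \<in> borel_measurable (lebesgue_vec N)" by measurable
    finally show ?thesis .
  next
    case False
    then have "(\<lambda>x. normalize_vec N x i) = (\<lambda>x. 0)" using assms by (auto simp: normalize_vec_def)
    then show ?thesis by simp
  qed
qed (rule normalize_vec_sphere[OF assms])

lemma prob_space_sphere_law:
  assumes "N > 0"
  shows "prob_space (sphere_law N)"
  unfolding sphere_law_def
  by (intro prob_space.prob_space_distr prob_space_uniform_measure)
    (use emeasure_punctured_ball[OF assms] measurable_normalize_vec[OF assms] in \<open>auto simp: uniform_measure_def\<close>)

text \<open>Unitary maps preserve norms, hence they commute with normalisation and preserve the
  punctured ball; invariance is inherited from Lebesgue measure.\<close>

lemma sphere_law_invariant:
  assumes N: "N > 0" and g: "g \<in> unitary_group N" and f: "f \<in> borel_measurable (sphere_law N)"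
  shows "(\<integral>\<^sup>+v. f (mat_vec N g v) \<partial>sphere_law N) = (\<integral>\<^sup>+v. f v \<partial>sphere_law N)"
proof -
  let ?L = "lebesgue_vec N"
  let ?U = "uniform_measure ?L (punctured_ball N)"
  have f': "f \<in> borel_measurable (sphere_space N)"
    using f measurable_cong_sets[OF sets_sphere_law refl] by blast
  have nU: "normalize_vec N \<in> measurable ?U (sphere_space N)"
    using measurable_normalize_vec[OF N] by (simp add: uniform_measure_def)
  have gm: "mat_vec N g \<in> measurable (sphere_space N) (sphere_space N)"
    by (rule measurable_sphereI[OF measurable_mat_vec _ refl])
      (auto intro: measurable_ident_restrict mat_vec_sphere[OF g] simp: space_restrict_space)
  have int: "(\<integral>\<^sup>+v. h v \<partial>sphere_law N) = (\<integral>\<^sup>+x. h (normalize_vec N x) * indicator (punctured_ball N) x \<partial>?L) 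
      / emeasure ?L (punctured_ball N)" if "h \<in> borel_measurable (sphere_space N)" for h
    unfolding sphere_law_def using measurable_compose[OF measurable_normalize_vec[OF N] that]
    by (simp add: nn_integral_distr_target[OF nU that] nn_integral_uniform_measure)
  have "(\<lambda>x. f (normalize_vec N x) * indicator (punctured_ball N) x) \<in> borel_measurable ?L"
    using measurable_compose[OF measurable_normalize_vec[OF N] f'] by simp
  from lebesgue_vec_unitary[OF g N this]
  have "(\<integral>\<^sup>+x. f (normalize_vec N x) * indicator (punctured_ball N) x \<partial>?L)
    = (\<integral>\<^sup>+x. f (normalize_vec N (\<lambda>i\<in>{..<N}. mat_vec N g x i)) * indicator (punctured_ball N) (\<lambda>i\<in>{..<N}. mat_vec N g x i) \<partial>?L)"
    by simp
  also have "\<dots> = (\<integral>\<^sup>+x. f (mat_vec N g (normalize_vec N x)) * indicator (punctured_ball N) x \<partial>?L)"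
  proof (rule nn_integral_cong)
    fix x assume x: "x \<in> space ?L"
    let ?y = "\<lambda>i\<in>{..<N}. mat_vec N g x i"
    have n: "(\<Sum>i<N. (cmod (?y i))\<^sup>2) = (\<Sum>i<N. (cmod (x i))\<^sup>2)"
      by (simp add: unitary_norm[OF g])
    have "?y \<in> space ?L" by (simp add: space_lebesgue_vec)
    then have i: "?y \<in> punctured_ball N \<longleftrightarrow> x \<in> punctured_ball N"
      using x by (simp only: punctured_ball_def mem_Collect_eq n)
    show "f (normalize_vec N ?y) * indicator (punctured_ball N) ?y
        = f (mat_vec N g (normalize_vec N x)) * indicator (punctured_ball N) x"
    proof (cases "x \<in> punctured_ball N")
      case True
      then have nz: "(\<Sum>i<N. (cmod (x i))\<^sup>2) \<noteq> 0" by (simp add: punctured_ball_def)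
      have "normalize_vec N ?y = mat_vec N g (normalize_vec N x)"
      proof
        fix j
        have "mat_vec N g (normalize_vec N x) j = mat_vec N g x j / complex_of_real (sqrt (\<Sum>i<N. (cmod (x i))\<^sup>2))"
          using nz by (simp add: mat_vec_def normalize_vec_def sum_divide_distrib)
        then show "normalize_vec N ?y j = mat_vec N g (normalize_vec N x) j"
          using nz n mat_vec_eq_0[OF g, of j] by (simp add: normalize_vec_def)
      qed
      then show ?thesis using i by (simp add: indicator_def)
    qed (use i in \<open>simp add: indicator_def\<close>)
  qed
  finally show ?thesis
    using int[OF f'] int[OF measurable_compose[OF gm f']] by simp
qed

subsection \<open>Recursive construction of Haar measure\<close>

definition assemble :: "nat \<Rightarrow> (nat \<Rightarrow> complex) \<times> (nat \<times> nat \<Rightarrow> complex) \<Rightarrow> (nat \<times> nat \<Rightarrow> complex)" where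
  "assemble n = (\<lambda>(v,W). mat_mult (Suc n) (reflection n v) (mat_extend n W))"

lemma assemble_unitary:
  "v \<in> unit_sphere (Suc n) \<Longrightarrow> W \<in> unitary_group n \<Longrightarrow> assemble n (v,W) \<in> unitary_group (Suc n)"
  by (simp add: assemble_def mat_mult_unitary reflection_unitary mat_extend_unitary)

lemma measurable_assemble:
  assumes "sets \<mu> = sets (unitary_space n)"
  shows "assemble n \<in> measurable (sphere_law (Suc n) \<Otimes>\<^sub>M \<mu>) (unitary_space (Suc n))"
proof (rule measurable_unitaryI[OF _ _ refl])
  have 1: "fst \<in> borel_measurable (sphere_law (Suc n) \<Otimes>\<^sub>M \<mu>)" "snd \<in> borel_measurable (sphere_law (Suc n) \<Otimes>\<^sub>M \<mu>)"
    using measurable_compose[OF measurable_fst measurable_ident_restrict[OF sets_sphere_law]]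
      measurable_compose[OF measurable_snd measurable_ident_restrict[OF assms]] by auto
  show "assemble n \<in> borel_measurable (sphere_law (Suc n) \<Otimes>\<^sub>M \<mu>)"
    unfolding assemble_def case_prod_beta
    by (intro measurable_mat_mult measurable_reflection measurable_mat_extend 1)
qed (auto simp: space_pair_measure space_sphere_law space_unitary[OF assms] intro: assemble_unitary)

text \<open>The matrix \<open>W0\<close> produced by \<open>mult_reflection\<close> depends on
  \<open>v\<close>, so \<open>W\<close> is integrated first: for fixed \<open>v\<close> the
  invariance of \<open>\<mu>\<close> absorbs \<open>W0\<close>, and afterwards the invariance of the
  sphere law absorbs \<open>V\<close>.\<close>

lemma left_invariant_prob_assemble:
  assumes mu: "left_invariant_prob n \<mu>"
  shows "left_invariant_prob (Suc n) (distr (sphere_law (Suc n) \<Otimes>\<^sub>M \<mu>) (unitary_space (Suc n)) (assemble n))"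
    (is "left_invariant_prob ?N ?D")
proof -
  let ?S = "sphere_law ?N"
  note smu = left_invariant_probD(1)[OF mu] and spmu = left_invariant_probD(3)[OF mu]
  interpret M: prob_space \<mu> by (rule left_invariant_probD[OF mu])
  interpret S: prob_space ?S by (rule prob_space_sphere_law) simp
  interpret P: pair_prob_space ?S \<mu> ..
  have am: "assemble n \<in> measurable (?S \<Otimes>\<^sub>M \<mu>) (unitary_space ?N)" by (rule measurable_assemble[OF smu])
  have "prob_space ?D" by (rule P.prob_space_distr[OF am])
  moreover have "distr ?D ?D (mat_mult ?N V) = ?D" if V: "V \<in> unitary_group ?N" for V
  proof (rule measure_eqI)
    fix A assume "A \<in> sets (distr ?D ?D (mat_mult ?N V))"
    then have A: "A \<in> sets (unitary_space ?N)" by simp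
    have Vm: "mat_mult ?N V \<in> measurable (unitary_space ?N) (unitary_space ?N)"
      using V by (intro measurable_unitaryI[OF measurable_mat_mult _ refl] measurable_ident_restrict[OF refl])
        (auto simp: space_restrict_space intro: mat_mult_unitary)
    let ?f = "indicator A :: _ \<Rightarrow> ennreal"
    have f: "?f \<in> borel_measurable (unitary_space ?N)" using A by simp
    have fa: "(\<lambda>p. ?f (assemble n p)) \<in> borel_measurable (?S \<Otimes>\<^sub>M \<mu>)"
      by (rule measurable_compose[OF am f])
    have fVa: "(\<lambda>p. ?f (mat_mult ?N V (assemble n p))) \<in> borel_measurable (?S \<Otimes>\<^sub>M \<mu>)"
      by (rule measurable_compose[OF am measurable_compose[OF Vm f]])
    have "emeasure (distr ?D ?D (mat_mult ?N V)) A = (\<integral>\<^sup>+U. ?f U \<partial>distr ?D ?D (mat_mult ?N V))"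
      using A by simp
    also have "\<dots> = (\<integral>\<^sup>+U. ?f (mat_mult ?N V U) \<partial>?D)"
      using Vm f by (intro nn_integral_distr) auto
    also have "\<dots> = (\<integral>\<^sup>+p. ?f (mat_mult ?N V (assemble n p)) \<partial>(?S \<Otimes>\<^sub>M \<mu>))"
      by (rule nn_integral_distr_target[OF am]) (rule measurable_compose[OF Vm f])
    also have "\<dots> = (\<integral>\<^sup>+v. (\<integral>\<^sup>+W. ?f (mat_mult ?N V (assemble n (v,W))) \<partial>\<mu>) \<partial>?S)"
      by (rule M.nn_integral_fst[symmetric, OF fVa])
    also have "\<dots> = (\<integral>\<^sup>+v. (\<integral>\<^sup>+W. ?f (assemble n (mat_vec ?N V v, W)) \<partial>\<mu>) \<partial>?S)"
    proof (rule nn_integral_cong)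
      fix v assume "v \<in> space ?S"
      then have v: "v \<in> unit_sphere ?N" by (simp add: space_sphere_law)
      then obtain W0 where W0: "W0 \<in> unitary_group n" "mat_mult ?N V (reflection n v)
          = mat_mult ?N (reflection n (mat_vec ?N V v)) (mat_extend n W0)"
        using mult_reflection[OF V] by blast
      have w: "mat_vec ?N V v \<in> space ?S" by (simp add: space_sphere_law mat_vec_sphere[OF V v])
      have "(\<integral>\<^sup>+W. ?f (mat_mult ?N V (assemble n (v,W))) \<partial>\<mu>)
          = (\<integral>\<^sup>+W. ?f (assemble n (mat_vec ?N V v, mat_mult n W0 W)) \<partial>\<mu>)"
      proof (rule nn_integral_cong)
        fix W assume "W \<in> space \<mu>"
        then have W: "W \<in> unitary_group n" by (simp add: spmu)
        have "mat_mult ?N V (assemble n (v,W)) = assemble n (mat_vec ?N V v, mat_mult n W0 W)"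
          by (simp add: assemble_def mat_mult_assoc[symmetric] W0 mat_extend_mult[OF W0(1) W, symmetric])
        then show "?f (mat_mult ?N V (assemble n (v,W))) = ?f (assemble n (mat_vec ?N V v, mat_mult n W0 W))"
          by simp
      qed
      also have "\<dots> = (\<integral>\<^sup>+W. ?f (assemble n (mat_vec ?N V v, W)) \<partial>\<mu>)"
        by (rule left_invariant_probD(5)[OF mu W0(1)])
          (use measurable_compose[OF measurable_Pair1'[OF w] fa] in simp)
      finally show "(\<integral>\<^sup>+W. ?f (mat_mult ?N V (assemble n (v,W))) \<partial>\<mu>)
          = (\<integral>\<^sup>+W. ?f (assemble n (mat_vec ?N V v, W)) \<partial>\<mu>)" .
    qed
    also have "\<dots> = (\<integral>\<^sup>+v. (\<integral>\<^sup>+W. ?f (assemble n (v, W)) \<partial>\<mu>) \<partial>?S)"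
      by (rule sphere_law_invariant[OF _ V, where f="\<lambda>v. \<integral>\<^sup>+W. ?f (assemble n (v, W)) \<partial>\<mu>"])
        (use M.borel_measurable_nn_integral_fst[OF fa] in auto)
    also have "\<dots> = (\<integral>\<^sup>+p. ?f (assemble n p) \<partial>(?S \<Otimes>\<^sub>M \<mu>))"
      by (rule M.nn_integral_fst[OF fa])
    also have "\<dots> = (\<integral>\<^sup>+U. ?f U \<partial>?D)"
      by (rule nn_integral_distr_target[OF am f, symmetric])
    also have "\<dots> = emeasure ?D A" using A by simp
    finally show "emeasure (distr ?D ?D (mat_mult ?N V)) A = emeasure ?D A" .
  qed simp
  ultimately show ?thesis by (simp add: left_invariant_prob_def)
qed

text \<open>Starting the recursion at dimension 0, where the group is a single point and the
  determinant is 1, makes the base case of the later product formula an empty product.\<close>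

lemma left_invariant_prob_0: "left_invariant_prob 0 (return (unitary_space 0) (\<lambda>_. 0))"
proof -
  have U: "unitary_group 0 = {\<lambda>_. 0}"
    by (auto simp: unitary_group_def mat_mult_def mat_id_def fun_eq_iff)
  have 0: "mat_mult 0 V = (\<lambda>_ _. 0)" for V
    by (auto simp: mat_mult_def fun_eq_iff)
  have "prob_space (return (unitary_space 0) (\<lambda>_. 0))"
    by (rule prob_space_return) (simp add: space_restrict_space U)
  moreover have "distr (return (unitary_space 0) (\<lambda>_. 0)) (return (unitary_space 0) (\<lambda>_. 0)) (\<lambda>_ _. 0)
      = return (unitary_space 0) (\<lambda>_. 0)"
    by (subst distr_return) (auto simp: space_restrict_space U intro!: return_cong measurable_const)
  ultimately show ?thesis by (simp add: left_invariant_prob_def 0)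
qed

lemma left_invariant_prob_haar: "left_invariant_prob N (haar N)"
proof -
  have "\<exists>\<mu>. left_invariant_prob N \<mu>"
    by (induction N) (use left_invariant_prob_0 left_invariant_prob_assemble in blast)+
  then show ?thesis using haar_eqI by metis
qed

text \<open>Uniqueness transfers the recursion from the constructed measure to \<open>haar\<close>,
  which opens induction on the dimension for Haar integrals.\<close>

lemma haar_Suc: "haar (Suc n) = distr (sphere_law (Suc n) \<Otimes>\<^sub>M haar n) (unitary_space (Suc n)) (assemble n)"
  by (rule haar_eqI[OF left_invariant_prob_assemble[OF left_invariant_prob_haar]])


subsection \<open>Moments of a coordinate on the sphere\<close>

lemma sphere_coordinate_le_1:
  assumes "v \<in> unit_sphere N"
  shows "cmod (v i) \<le> 1"
proof (cases "i < N")
  case True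
  have "(cmod (v i))\<^sup>2 \<le> (\<Sum>i<N. (cmod (v i))\<^sup>2)"
    using True by (intro member_le_sum) auto
  then show ?thesis using assms power2_le_imp_le[of "cmod (v i)" 1] by (simp add: unit_sphere_def)
qed (use assms in \<open>simp add: unit_sphere_def\<close>)

lemma measurable_sphere_coordinate [measurable]:
  "(\<lambda>v. v i) \<in> borel_measurable (sphere_law N)"
  by (rule measurable_coordinate[OF measurable_ident_restrict[OF sets_sphere_law]])

lemma mat_vec_reflection:
  assumes v: "v \<in> unit_sphere (Suc n)" and u: "u = (\<lambda>i. (if i = n then 1 else 0) - w i)"
  shows "mat_vec (Suc n) (reflection n w) v i = v i - u i * (\<Sum>l<Suc n. cnj (u l) * v l) / cnj (u n)"
proof -
  have "mat_vec (Suc n) (reflection n w) v i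
      = mat_vec (Suc n) (mat_id (Suc n)) v i - (\<Sum>l<Suc n. u i * cnj (u l) / cnj (u n) * v l)"
    unfolding mat_vec_def reflection_eq[OF u] by (simp only: left_diff_distrib sum_subtractf)
  also have "mat_vec (Suc n) (mat_id (Suc n)) v = v"
    using v by (intro mat_id_vec) (auto simp: unit_sphere_def)
  finally show ?thesis
    by (simp add: sum_distrib_left sum_divide_distrib mult_ac del: sum.lessThan_Suc)
qed

context
  fixes n :: nat
begin

interpretation S: prob_space "sphere_law (Suc n)" by (rule prob_space_sphere_law) simp

lemma sphere_integrableI:
  fixes f :: "(nat \<Rightarrow> complex) \<Rightarrow> 'b :: {banach, second_countable_topology}"
  assumes "f \<in> borel_measurable (sphere_law (Suc n))" "\<And>v. v \<in> unit_sphere (Suc n) \<Longrightarrow> norm (f v) \<le> C"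
  shows "integrable (sphere_law (Suc n)) f"
  using assms by (intro S.integrable_const_bound[where B=C] AE_I2) (auto simp: space_sphere_law)

lemma distr_sphere_law:
  assumes g: "g \<in> unitary_group (Suc n)"
  shows "distr (sphere_law (Suc n)) (sphere_law (Suc n)) (mat_vec (Suc n) g) = sphere_law (Suc n)"
    "mat_vec (Suc n) g \<in> measurable (sphere_law (Suc n)) (sphere_law (Suc n))"
proof -
  let ?S = "sphere_law (Suc n)"
  show gm: "mat_vec (Suc n) g \<in> measurable ?S ?S"
    by (rule measurable_sphereI[OF measurable_mat_vec _ sets_sphere_law])
      (auto intro: measurable_ident_restrict[OF sets_sphere_law] mat_vec_sphere[OF g] simp: space_sphere_law)
  show "distr ?S ?S (mat_vec (Suc n) g) = ?S"
  proof (rule measure_eqI)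
    fix A assume "A \<in> sets (distr ?S ?S (mat_vec (Suc n) g))"
    then have A: "A \<in> sets ?S" by simp
    have "emeasure (distr ?S ?S (mat_vec (Suc n) g)) A = (\<integral>\<^sup>+v. indicator A v \<partial>distr ?S ?S (mat_vec (Suc n) g))"
      using A by simp
    also have "\<dots> = (\<integral>\<^sup>+v. indicator A (mat_vec (Suc n) g v) \<partial>?S)"
      by (rule nn_integral_distr_target[OF gm]) (use A in simp)
    also have "\<dots> = emeasure ?S A"
      using A by (subst sphere_law_invariant[OF _ g]) auto
    finally show "emeasure (distr ?S ?S (mat_vec (Suc n) g)) A = emeasure ?S A" .
  qed simp
qed

lemma sphere_integral_invariant:
  fixes f :: "(nat \<Rightarrow> complex) \<Rightarrow> 'b :: {banach, second_countable_topology}"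
  assumes g: "g \<in> unitary_group (Suc n)" and f: "f \<in> borel_measurable (sphere_law (Suc n))"
  shows "(\<integral>v. f (mat_vec (Suc n) g v) \<partial>sphere_law (Suc n)) = (\<integral>v. f v \<partial>sphere_law (Suc n))"
  using integral_distr[OF distr_sphere_law(2)[OF g] f] by (simp add: distr_sphere_law(1)[OF g])

text \<open>Invariance under the scalar matrix \<open>c I\<close>. The choices \<open>c = -1\<close>
  and \<open>c = \<i>\<close> negate \<open>v n\<close> and its square, which makes the two
  unconjugated moments below vanish.\<close>

lemma sphere_integral_rotate:
  fixes h :: "complex \<Rightarrow> 'b :: {banach, second_countable_topology}"
  assumes c: "cmod c = 1" and h: "h \<in> borel_measurable borel"
  shows "(\<integral>v. h (c * v n) \<partial>sphere_law (Suc n)) = (\<integral>v. h (v n) \<partial>sphere_law (Suc n))"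
proof -
  let ?g = "\<lambda>p. c * mat_id (Suc n) p"
  note [measurable] = h
  have "mat_vec (Suc n) ?g v n = c * v n" if "v \<in> unit_sphere (Suc n)" for v
  proof -
    have "mat_vec (Suc n) ?g v n = c * mat_vec (Suc n) (mat_id (Suc n)) v n"
      by (simp add: mat_vec_def sum_distrib_left mult.assoc distrib_left)
    also have "mat_vec (Suc n) (mat_id (Suc n)) v = v"
      using that by (intro mat_id_vec) (auto simp: unit_sphere_def)
    finally show ?thesis .
  qed
  then have "(\<integral>v. h (c * v n) \<partial>sphere_law (Suc n)) = (\<integral>v. h (mat_vec (Suc n) ?g v n) \<partial>sphere_law (Suc n))"
    by (intro Bochner_Integration.integral_cong) (auto simp: space_sphere_law)
  also have "\<dots> = (\<integral>v. h (v n) \<partial>sphere_law (Suc n))"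
    by (rule sphere_integral_invariant[OF scalar_unitary(1)[OF c]]) measurable
  finally show ?thesis .
qed

lemma sphere_coordinate_mean: "(\<integral>v. v n \<partial>sphere_law (Suc n)) = 0"
  using sphere_integral_rotate[of "-1" "\<lambda>z. z"] by simp

lemma sphere_coordinate_square: "(\<integral>v. (v n)\<^sup>2 \<partial>sphere_law (Suc n)) = 0"
  using sphere_integral_rotate[of \<i> "\<lambda>z. z\<^sup>2"] by (simp add: power_mult_distrib)

text \<open>By rotation invariance the events \<open>v n = c\<close> are equally likely for all
  \<open>c\<close> on the unit circle. Infinitely many of them are disjoint, so each has probability
  0.\<close>

lemma sphere_coordinate_ne_1: "AE v in sphere_law (Suc n). v n \<noteq> 1"
proof -
  let ?S = "sphere_law (Suc n)"
  \<comment> \<open>Points of the unit circle with real part \<open>1 / (m + 1)\<close>: an explicit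
    injective sequence.\<close>
  define c where "c m = Complex (1 / (real m + 1)) (sqrt (1 - (1 / (real m + 1))\<^sup>2))" for m
  have c1: "cmod (c m) = 1" for m
  proof -
    have "(1 / (real m + 1))\<^sup>2 \<le> 1" by (intro power_le_one) (auto simp: field_simps)
    then show ?thesis by (simp add: c_def complex_norm)
  qed
  have inj: "c m = c m' \<Longrightarrow> m = m'" for m m'
    by (auto simp: c_def)
  define A where "A z = {v \<in> space ?S. v n = z}" for z
  have A: "A z \<in> sets ?S" for z unfolding A_def by measurable
  have eq: "measure ?S (A (c m)) = measure ?S (A 1)" for m
  proof -
    have c0: "c m \<noteq> 0" using c1[of m] by force
    have "measure ?S (A (c m)) = (\<integral>v. indicator {c m} (v n) \<partial>?S)"
      using A[of "c m"] by (subst Bochner_Integration.integral_cong[OF refl, where g="indicator (A (c m))"])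
        (auto simp: A_def indicator_def)
    also have "\<dots> = (\<integral>v. indicator {c m} (c m * v n) \<partial>?S :: real)"
      by (rule sphere_integral_rotate[symmetric, OF c1]) measurable
    also have "\<dots> = measure ?S (A 1)"
      using A[of 1] by (subst Bochner_Integration.integral_cong[OF refl, where g="indicator (A 1)"])
        (auto simp: A_def indicator_def c0)
    finally show ?thesis .
  qed
  have "(\<lambda>m. measure ?S (A (c m))) sums measure ?S (\<Union>m. A (c m))"
    by (rule S.finite_measure_UNION) (use A inj in \<open>auto simp: disjoint_family_on_def A_def\<close>)
  then have "summable (\<lambda>m::nat. measure ?S (A 1))" by (simp add: eq sums_iff)
  then have "measure ?S (A 1) = 0" by (simp add: summable_const_iff)
  then have "A 1 \<in> null_sets ?S" using A by (simp add: null_sets_def S.emeasure_eq_measure)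
  then show ?thesis by (rule AE_I') (auto simp: A_def)
qed

text \<open>The three unitaries are obtained as \<open>reflection n w\<close> with \<open>w\<close>
  supported on the coordinates \<open>n\<close> and \<open>b\<close>. The entries
  \<open>(w n, w b)\<close> are \<open>(0, 1)\<close> for the swap, \<open>(\<i>, 0)\<close> for the
  phase and \<open>(s, s)\<close> with \<open>s = 1 / sqrt 2\<close> for the 45 degree
  rotation.\<close>

lemma sphere_pair_invariance:
  fixes h :: "complex \<Rightarrow> complex \<Rightarrow> complex"
  assumes b: "b < n" and h: "case_prod h \<in> borel_measurable (borel \<Otimes>\<^sub>M borel)"
  shows "(\<integral>v. h (v b) (v n) \<partial>sphere_law (Suc n)) = (\<integral>v. h (v n) (v b) \<partial>sphere_law (Suc n))" (is ?swap)
    "(\<integral>v. h (\<i> * v n) (v b) \<partial>sphere_law (Suc n)) = (\<integral>v. h (v n) (v b) \<partial>sphere_law (Suc n))" (is ?phase)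
    "(\<integral>v. h ((v n + v b) / sqrt 2) ((v n - v b) / sqrt 2) \<partial>sphere_law (Suc n)) = (\<integral>v. h (v n) (v b) \<partial>sphere_law (Suc n))" (is ?rot)
proof -
  let ?S = "sphere_law (Suc n)"
  have hm: "(\<lambda>v. h (v n) (v b)) \<in> borel_measurable ?S"
    using measurable_compose[OF measurable_Pair[OF measurable_sphere_coordinate measurable_sphere_coordinate] h]
    by simp
  have two: "(\<Sum>l<Suc n. f l) = f n + f b" if "\<And>l. l \<noteq> n \<Longrightarrow> l \<noteq> b \<Longrightarrow> f l = 0" for f :: "nat \<Rightarrow> 'z::comm_monoid_add"
  proof -
    have "(\<Sum>l<n. f l) = (\<Sum>l<n. if l = b then f l else 0)"
      by (rule sum.cong) (use that in auto)
    then show ?thesis using b by (simp add: add.commute)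
  qed
  have act: "(\<integral>v. h (F v) (G v) \<partial>?S) = (\<integral>v. h (v n) (v b) \<partial>?S)"
    if w: "w \<in> unit_sphere (Suc n)" 
      and F: "\<And>v. v \<in> unit_sphere (Suc n) \<Longrightarrow> mat_vec (Suc n) (reflection n w) v n = F v"
      and G: "\<And>v. v \<in> unit_sphere (Suc n) \<Longrightarrow> mat_vec (Suc n) (reflection n w) v b = G v" for w F G
  proof -
    have "(\<integral>v. h (F v) (G v) \<partial>?S) = (\<integral>v. h (mat_vec (Suc n) (reflection n w) v n) (mat_vec (Suc n) (reflection n w) v b) \<partial>?S)"
      by (rule Bochner_Integration.integral_cong) (simp_all add: space_sphere_law F G)
    also have "\<dots> = (\<integral>v. h (v n) (v b) \<partial>?S)"
      by (rule sphere_integral_invariant[OF reflection_unitary[OF w] hm])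
    finally show ?thesis .
  qed
  have refl2: "mat_vec (Suc n) (reflection n (\<lambda>i. if i = n then p else if i = b then q else 0)) v i
     = v i - (if i = n then 1 - p else if i = b then - q else 0) * (cnj (1 - p) * v n - cnj q * v b) / cnj (1 - p)"
    if "v \<in> unit_sphere (Suc n)" for v p q i
    using b by (subst mat_vec_reflection[OF that refl], subst two) auto
  have sph: "(\<lambda>i. if i = n then p else if i = b then q else 0) \<in> unit_sphere (Suc n)"
    if "(cmod p)\<^sup>2 + (cmod q)\<^sup>2 = 1" for p q
    unfolding unit_sphere_def mem_Collect_eq by (subst two) (use b that in auto)
  show ?swap
    by (rule act[OF sph[of 0 1]]) (use b in \<open>auto simp: refl2\<close>)
  have "1 + \<i> \<noteq> 0" by (simp add: complex_eq_iff)
  then show ?phase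
    by (intro act[OF sph[of \<i> 0]]) (use b in \<open>auto simp: refl2 field_simps\<close>)
  define s where "s = complex_of_real (1 / sqrt 2)"
  have s2: "s * s = 1 / 2" by (simp add: s_def flip: of_real_mult)
  have s1: "1 - s \<noteq> 0" using s2 by auto
  have cs: "cnj s = s" by (simp add: s_def)
  have "(cmod s)\<^sup>2 + (cmod s)\<^sup>2 = 1" by (simp add: s_def power_divide norm_divide)
  then show ?rot
  proof (intro act[OF sph[of s s]])
    fix v assume v: "v \<in> unit_sphere (Suc n)"
    show "mat_vec (Suc n) (reflection n (\<lambda>i. if i = n then s else if i = b then s else 0)) v n
      = (v n + v b) / sqrt 2"
      using b s1 by (simp add: refl2[OF v] cs) (simp add: s_def algebra_simps add_divide_distrib)
    have "v b + s * ((1 - s) * v n - s * v b) / (1 - s) = s * v n + v b * (1 - s - s * s) / (1 - s)"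
      using s1 by (simp add: field_simps)
    also have "1 - s - s * s = - s * (1 - s)" by (simp add: s2 algebra_simps)
    also have "s * v n + v b * (- s * (1 - s)) / (1 - s) = s * (v n - v b)"
      using s1 by (simp add: field_simps)
    finally show "mat_vec (Suc n) (reflection n (\<lambda>i. if i = n then s else if i = b then s else 0)) v b
      = (v n - v b) / sqrt 2"
      using b by (simp add: refl2[OF v] cs) (simp add: s_def)
  qed
qed

text \<open>By the swap all \<open>n + 1\<close> coordinates have the same second moment, and these
  moments add up to 1.\<close>

lemma sphere_coordinate_moment2: "(\<integral>v. (cmod (v n))\<^sup>2 \<partial>sphere_law (Suc n)) = 1 / real (Suc n)"
proof -
  let ?S = "sphere_law (Suc n)"
  have int: "integrable ?S (\<lambda>v. (cmod (v i))\<^sup>2)" for i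
    by (rule sphere_integrableI[where C=1]) (auto simp: sphere_coordinate_le_1 power_le_one)
  have eq: "(\<integral>v. (cmod (v i))\<^sup>2 \<partial>?S) = (\<integral>v. (cmod (v n))\<^sup>2 \<partial>?S)" if "i < Suc n" for i
  proof (cases "i = n")
    case False
    then have "i < n" using that by simp
    from sphere_pair_invariance(1)[OF this, of "\<lambda>x y. complex_of_real ((cmod x)\<^sup>2)"]
    have "(\<integral>v. complex_of_real ((cmod (v i))\<^sup>2) \<partial>?S) = (\<integral>v. complex_of_real ((cmod (v n))\<^sup>2) \<partial>?S)"
      by simp
    then show ?thesis by (simp only: integral_complex_of_real of_real_eq_iff)
  qed simp
  have "1 = (\<integral>v. (1::real) \<partial>?S)" by (simp add: S.prob_space)
  also have "\<dots> = (\<integral>v. (\<Sum>i<Suc n. (cmod (v i))\<^sup>2) \<partial>?S)"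
    by (rule Bochner_Integration.integral_cong) (auto simp: space_sphere_law unit_sphere_def)
  also have "\<dots> = (\<Sum>i<Suc n. \<integral>v. (cmod (v i))\<^sup>2 \<partial>?S)"
    by (rule Bochner_Integration.integral_sum) (rule int)
  also have "\<dots> = (\<Sum>i<Suc n. \<integral>v. (cmod (v n))\<^sup>2 \<partial>?S)"
    by (intro sum.cong refl eq) simp
  also have "\<dots> = real (Suc n) * (\<integral>v. (cmod (v n))\<^sup>2 \<partial>?S)"
    by (simp only: sum_constant card_lessThan)
  finally show ?thesis by (simp add: field_simps)
qed

text \<open>The 45 degree rotation expresses the mixed moment of two coordinates through the fourth
  moment \<open>A\<close>, as \<open>A / 2\<close>; the equation of the sphere then determines
  \<open>A\<close>.\<close>

lemma sphere_coordinate_moment4: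
  "(\<integral>v. (cmod (v n)) ^ 4 \<partial>sphere_law (Suc n)) = 2 / (real (Suc n) * real (Suc (Suc n)))"
proof -
  let ?S = "sphere_law (Suc n)"
  define A where "A = (\<integral>v. (cmod (v n)) ^ 4 \<partial>?S)"
  have int4: "integrable ?S (\<lambda>v. (cmod (v i)) ^ 4)" for i
    by (rule sphere_integrableI[where C=1]) (auto simp: sphere_coordinate_le_1 power_le_one)
  have int22: "integrable ?S (\<lambda>v. (cmod (v i))\<^sup>2 * (cmod (v j))\<^sup>2)" for i j
    by (rule sphere_integrableI[where C=1]) (auto simp: sphere_coordinate_le_1 power_le_one intro!: mult_le_one)
  have int': "integrable ?S (\<lambda>v. (v i)\<^sup>2 * (cnj (v j))\<^sup>2)" for i j
    by (rule sphere_integrableI[where C=1])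
      (auto simp: sphere_coordinate_le_1 power_le_one norm_mult norm_power intro!: mult_le_one)
  have B: "(\<integral>v. (cmod (v n))\<^sup>2 * (cmod (v b))\<^sup>2 \<partial>?S) = A / 2" if b: "b < n" for b
  proof -
    \<comment> \<open>The phase \<open>\<i>\<close> on coordinate \<open>n\<close> changes the sign
      of this integral.\<close>
    have cross: "(\<integral>v. (v n)\<^sup>2 * (cnj (v b))\<^sup>2 \<partial>?S) = 0"
      using sphere_pair_invariance(2)[OF b, of "\<lambda>x y. x\<^sup>2 * (cnj y)\<^sup>2"]
      by (simp add: power_mult_distrib)
    have Ab: "(\<integral>v. (cmod (v b)) ^ 4 \<partial>?S) = A"
    proof -
      from sphere_pair_invariance(1)[OF b, of "\<lambda>x y. complex_of_real ((cmod x) ^ 4)"]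
      have "(\<integral>v. complex_of_real ((cmod (v b)) ^ 4) \<partial>?S) = (\<integral>v. complex_of_real ((cmod (v n)) ^ 4) \<partial>?S)"
        by simp
      then show ?thesis by (simp only: integral_complex_of_real of_real_eq_iff A_def)
    qed
    have alg: "(cmod ((x + y) / sqrt 2))\<^sup>2 * (cmod ((x - y) / sqrt 2))\<^sup>2
        = ((cmod x) ^ 4 + (cmod y) ^ 4 - 2 * Re (x\<^sup>2 * (cnj y)\<^sup>2)) / 4" for x y :: complex
    proof -
      have "(cmod ((x + y) / sqrt 2))\<^sup>2 * (cmod ((x - y) / sqrt 2))\<^sup>2 = (cmod (x\<^sup>2 - y\<^sup>2))\<^sup>2 / 4"
      proof -
        have "x\<^sup>2 - y\<^sup>2 = (x + y) * (x - y)" by (simp add: power2_eq_square algebra_simps)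
        then show ?thesis by (simp add: norm_divide norm_mult power_divide power_mult_distrib)
      qed
      also have "(cmod (x\<^sup>2 - y\<^sup>2))\<^sup>2 = (cmod (x\<^sup>2))\<^sup>2 + (cmod (y\<^sup>2))\<^sup>2 - 2 * Re (x\<^sup>2 * cnj (y\<^sup>2))"
        by (simp only: cmod_power2) (simp add: power2_eq_square algebra_simps)
      finally show ?thesis by (simp add: norm_power flip: power_mult)
    qed
    have "complex_of_real (\<integral>v. (cmod (v n))\<^sup>2 * (cmod (v b))\<^sup>2 \<partial>?S)
        = (\<integral>v. complex_of_real ((cmod ((v n + v b) / sqrt 2))\<^sup>2 * (cmod ((v n - v b) / sqrt 2))\<^sup>2) \<partial>?S)"
      unfolding integral_complex_of_real[symmetric]
      by (rule sphere_pair_invariance(3)[OF b, of "\<lambda>x y. complex_of_real ((cmod x)\<^sup>2 * (cmod y)\<^sup>2)", symmetric]) measurable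
    also have "\<dots> = complex_of_real (\<integral>v. ((cmod (v n)) ^ 4 + (cmod (v b)) ^ 4 - 2 * Re ((v n)\<^sup>2 * (cnj (v b))\<^sup>2)) / 4 \<partial>?S)"
      unfolding integral_complex_of_real[symmetric]
      by (rule Bochner_Integration.integral_cong) (simp_all only: alg)
    finally have "(\<integral>v. (cmod (v n))\<^sup>2 * (cmod (v b))\<^sup>2 \<partial>?S)
        = (\<integral>v. ((cmod (v n)) ^ 4 + (cmod (v b)) ^ 4 - 2 * Re ((v n)\<^sup>2 * (cnj (v b))\<^sup>2)) / 4 \<partial>?S)"
      by (simp only: of_real_eq_iff)
    also have "\<dots> = (A + A - 2 * Re (\<integral>v. (v n)\<^sup>2 * (cnj (v b))\<^sup>2 \<partial>?S)) / 4"
    proof -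
      define R where "R v = Re ((v n)\<^sup>2 * (cnj (v b))\<^sup>2)" for v
      have "integrable ?S R" "(\<integral>v. R v \<partial>?S) = Re (\<integral>v. (v n)\<^sup>2 * (cnj (v b))\<^sup>2 \<partial>?S)"
        unfolding R_def by (intro integrable_Re int', intro integral_Re int')
      then show ?thesis unfolding R_def[symmetric] using int4 Ab by (simp add: A_def)
    qed
    also have "\<dots> = A / 2" by (simp add: cross)
    finally show ?thesis .
  qed
  \<comment> \<open>Multiplying by the squared norm, which is 1, and expanding gives one linear
    equation for \<open>A\<close>: \<open>n\<close> mixed moments and one fourth moment.\<close>
  have "1 / real (Suc n) = (\<integral>v. (cmod (v n))\<^sup>2 * (\<Sum>b<Suc n. (cmod (v b))\<^sup>2) \<partial>?S)"
    unfolding sphere_coordinate_moment2[symmetric]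
    by (rule Bochner_Integration.integral_cong) (auto simp: space_sphere_law unit_sphere_def)
  also have "\<dots> = (\<integral>v. (\<Sum>b<n. (cmod (v n))\<^sup>2 * (cmod (v b))\<^sup>2) + (cmod (v n)) ^ 4 \<partial>?S)"
    by (rule Bochner_Integration.integral_cong[OF refl])
      (simp add: sum_distrib_left distrib_left flip: power_add)
  also have "\<dots> = real n * (A / 2) + A"
  proof -
    have "(\<integral>v. (\<Sum>b<n. (cmod (v n))\<^sup>2 * (cmod (v b))\<^sup>2) + (cmod (v n)) ^ 4 \<partial>?S)
        = (\<integral>v. (\<Sum>b<n. (cmod (v n))\<^sup>2 * (cmod (v b))\<^sup>2) \<partial>?S) + A"
      unfolding A_def by (intro Bochner_Integration.integral_add Bochner_Integration.integrable_sum int22 int4)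
    also have "(\<integral>v. (\<Sum>b<n. (cmod (v n))\<^sup>2 * (cmod (v b))\<^sup>2) \<partial>?S)
        = (\<Sum>b<n. \<integral>v. (cmod (v n))\<^sup>2 * (cmod (v b))\<^sup>2 \<partial>?S)"
      by (intro Bochner_Integration.integral_sum int22)
    also have "\<dots> = (\<Sum>b<n. A / 2)"
      by (intro sum.cong refl B) simp
    finally show ?thesis by simp
  qed
  finally have "1 / real (Suc n) = real n * (A / 2) + A" .
  then have "A * (real n + 2) = 2 * (1 / real (Suc n))" by (simp only:) (simp add: algebra_simps)
  then have "A * (real n + 2) = 2 / real (Suc n)" by simp
  moreover have "real (Suc (Suc n)) = real n + 2" by simp
  ultimately have "A = 2 / (real (Suc n) * real (Suc (Suc n)))"
    by (metis divide_divide_eq_left nonzero_eq_divide_eq of_nat_0_eq_iff nat.distinct(2))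
  then show ?thesis by (simp only: A_def)
qed

end


subsection \<open>Mellin transform of one factor\<close>

text \<open>The power \<open>x^(2 k + \<i> \<tau>)\<close> for \<open>x > 0\<close>. The value 0 at
  0 keeps the kernel multiplicative also for \<open>k = 0\<close>, and turns the kernel with
  \<open>k = 0\<close> and \<open>\<tau> = 0\<close> into the indicator of
  \<open>x \<noteq> 0\<close> on nonnegative \<open>x\<close>.\<close>

definition mellin_kernel :: "nat \<Rightarrow> real \<Rightarrow> real \<Rightarrow> complex" where
  "mellin_kernel k \<tau> x = (if x = 0 then 0 else complex_of_real (x ^ (2 * k)) * cis (\<tau> * ln x))"

definition mellin_exponent :: "nat \<Rightarrow> real \<Rightarrow> complex" where
  "mellin_exponent k \<tau> = of_nat k + \<i> * of_real (\<tau> / 2)"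

lemma mellin_kernel_mult:
  assumes "x \<ge> 0" "y \<ge> 0"
  shows "mellin_kernel k \<tau> (x * y) = mellin_kernel k \<tau> x * mellin_kernel k \<tau> y"
  using assms by (auto simp: mellin_kernel_def ln_mult_pos power_mult_distrib distrib_left cis_mult[symmetric])

lemma mellin_kernel_eq_exp:
  assumes "x > 0"
  shows "mellin_kernel k \<tau> x = exp (mellin_exponent k \<tau> * of_real (2 * ln x))"
proof -
  have "complex_of_real (x ^ (2 * k)) = exp (of_real (real (2 * k) * ln x))"
    using assms exp_of_nat_mult[of "2 * k" "ln x"] by (simp only: exp_of_real exp_ln)
  then show ?thesis using assms
    by (simp add: mellin_kernel_def cis_conv_exp mellin_exponent_def exp_add[symmetric] algebra_simps)
qed

lemma norm_mellin_kernel: "x \<ge> 0 \<Longrightarrow> cmod (mellin_kernel k \<tau> x) \<le> x ^ (2 * k)"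
  by (simp add: mellin_kernel_def norm_mult norm_power)

lemma measurable_mellin_kernel [measurable]: "mellin_kernel k \<tau> \<in> borel_measurable borel"
proof -
  have "(\<lambda>x. cis (\<tau> * ln x)) \<in> borel_measurable borel"
    unfolding cis_conv_exp by measurable
  then show ?thesis unfolding mellin_kernel_def[abs_def] by measurable
qed

lemma norm_mellin_exponent: "\<bar>\<tau>\<bar> \<le> 1 \<Longrightarrow> cmod (mellin_exponent k \<tau>) \<le> real k + 1"
  unfolding mellin_exponent_def by (rule norm_triangle_le) (simp add: norm_mult)

text \<open>Taylor's theorem of order 2: on the disc of radius 1/2 the third derivative
  \<open>2 / (1 + w)^3\<close> has modulus at most 16, and division by \<open>fact 2\<close> leaves
  8.\<close>

lemma Ln_approx_quadratic:
  assumes "cmod w \<le> 1/2"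
  shows "cmod (Ln (1 + w) - w + w\<^sup>2 / 2) \<le> 8 * cmod w ^ 3"
proof -
  define f where "f i w = (if i = 0 then Ln (1 + w) else if i = 1 then inverse (1 + w)
    else if i = 2 then - inverse ((1 + w) ^ 2) else 2 * inverse ((1 + w) ^ 3))" for i :: nat and w :: complex
  have re: "Re (1 + x) > 0" if "x \<in> cball 0 (1/2)" for x :: complex
    using that abs_Re_le_cmod[of x] by simp
  have nz: "1 + x \<noteq> 0" "1 + x \<notin> \<real>\<^sub>\<le>\<^sub>0" if "x \<in> cball 0 (1/2)" for x :: complex
    using re[OF that] by (auto simp: complex_nonpos_Reals_iff complex_eq_iff)
  have lower: "cmod (1 + x) \<ge> 1/2" if "x \<in> cball 0 (1/2)" for x :: complex
    using that norm_triangle_ineq2[of 1 "- x"] by simp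
  have "cmod (f 0 w - (\<Sum>i\<le>2. f i 0 * (w - 0) ^ i / fact i)) \<le> 16 * cmod (w - 0) ^ Suc 2 / fact 2"
  proof (rule complex_Taylor[of "cball 0 (1/2)"])
    fix i and x :: complex assume x: "x \<in> cball 0 (1/2)" and "i \<le> (2::nat)"
    then consider "i = 0" | "i = 1" | "i = 2" by linarith
    then show "(f i has_field_derivative f (Suc i) x) (at x within cball 0 (1/2))"
    proof cases
      case 1
      have "((\<lambda>w. Ln (1 + w)) has_field_derivative inverse (1 + x)) (at x within cball 0 (1/2))"
        using nz[OF x] by (auto intro!: derivative_eq_intros simp: field_simps)
      then show ?thesis using 1 by (simp add: f_def[abs_def])
    next
      case 2
      have "((\<lambda>w. inverse (1 + w)) has_field_derivative - inverse ((1 + x) ^ 2)) (at x within cball 0 (1/2))"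
        using nz[OF x] by (auto intro!: derivative_eq_intros simp: power2_eq_square)
      then show ?thesis using 2 by (simp add: f_def[abs_def])
    next
      case 3
      have "((\<lambda>w. - inverse ((1 + w) ^ 2)) has_field_derivative 2 * inverse ((1 + x) ^ 3)) (at x within cball 0 (1/2))"
      proof -
        have y: "2 * inverse (y ^ 3) = inverse (y\<^sup>2) * (2 * y) * inverse (y\<^sup>2)" if "y \<noteq> 0" for y :: complex
          using that by (simp add: power2_eq_square power3_eq_cube field_simps)
        show ?thesis unfolding y[OF nz(1)[OF x]]
          using nz[OF x] by (auto intro!: derivative_eq_intros)
      qed
      then show ?thesis using 3 by (simp add: f_def[abs_def])
    qed
  next
    fix x assume x: "x \<in> cball (0::complex) (1/2)"
    have "(1/2) ^ 3 \<le> cmod (1 + x) ^ 3" by (intro power_mono lower x) auto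
    then have "inverse (cmod (1 + x) ^ 3) \<le> inverse ((1/2) ^ 3)" by (intro le_imp_inverse_le) auto
    then show "cmod (f (Suc 2) x) \<le> 16"
      by (simp add: f_def norm_mult norm_inverse norm_power power_divide)
  qed (use assms in auto)
  moreover have "f 0 w - (\<Sum>i\<le>2. f i 0 * (w - 0) ^ i / fact i) = Ln (1 + w) - w + w\<^sup>2 / 2"
    by (simp add: f_def eval_nat_numeral)
  ultimately show ?thesis by (simp add: eval_nat_numeral)
qed

text \<open>The second-order Taylor polynomial at 0 of the power \<open>2 a\<close> of
  \<open>cmod (1 - z)\<close>: insert \<open>2 ln (cmod (1 - z)) = - 2 Re z - Re (z^2) + ...\<close>
  into \<open>1 + a y + a^2 y^2 / 2\<close> and drop terms of order three.\<close>

definition mellin_quadratic :: "complex \<Rightarrow> complex \<Rightarrow> complex" where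
  "mellin_quadratic a z = 1 - a * of_real (2 * Re z + Re (z\<^sup>2)) + 2 * a\<^sup>2 * of_real ((Re z)\<^sup>2)"

text \<open>The three summands of the constant are the remainder of the exponential series, the
  error of the logarithm in the linear term, and the error of replacing \<open>y^2\<close> by
  \<open>4 (Re z)^2\<close> in the quadratic term.\<close>

lemma mellin_kernel_near:
  fixes k :: nat
  assumes tau: "\<bar>\<tau>\<bar> \<le> 1" and r: "cmod z \<le> 1/2"
  defines "K \<equiv> real k + 1" and "a \<equiv> mellin_exponent k \<tau>"
  shows "cmod (mellin_kernel k \<tau> (cmod (1 - z)) - mellin_quadratic a z)
     \<le> (exp (K * 4) * (K * 7) ^ 3 + K * 16 + K\<^sup>2 * 81) * cmod z ^ 3"
proof -
  let ?r = "cmod z"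
  have K: "K \<ge> 1" and a: "cmod a \<le> K"
    using norm_mellin_exponent[OF tau] by (simp_all add: K_def a_def)
  define e where "e = Ln (1 - z) + z + z\<^sup>2 / 2"
  have e: "cmod e \<le> 8 * ?r ^ 3"
    using Ln_approx_quadratic[of "- z"] r by (simp add: e_def)
  have nz: "1 - z \<noteq> 0" using r by auto
  define y where "y = 2 * ln (cmod (1 - z))"
  have y: "y = - 2 * Re z - Re (z\<^sup>2) + 2 * Re e"
  proof -
    have "y = 2 * Re (Ln (1 - z))" using nz by (simp add: y_def Re_Ln)
    then show ?thesis by (simp add: e_def)
  qed
  have r2: "?r\<^sup>2 \<le> ?r / 2"
    using r mult_left_mono[of ?r "1/2" ?r] by (simp add: power2_eq_square)
  have r3: "?r ^ 3 \<le> ?r\<^sup>2 / 2"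
    using r mult_left_mono[of ?r "1/2" "?r\<^sup>2"] by (simp add: power2_eq_square power3_eq_cube)
  have z1: "\<bar>Re z\<bar> \<le> ?r" and z2: "\<bar>Re (z\<^sup>2)\<bar> \<le> ?r\<^sup>2" and e1: "\<bar>Re e\<bar> \<le> 8 * ?r ^ 3"
    using abs_Re_le_cmod[of z] abs_Re_le_cmod[of "z\<^sup>2"] abs_Re_le_cmod[of e] e
    by (simp_all add: norm_power)
  \<comment> \<open>From \<open>?r^3 \<le> ?r^2 / 2 \<le> ?r / 4\<close>, the logarithm error
    \<open>16 ?r^3\<close> is at most \<open>8 ?r^2\<close> and at most \<open>4 ?r\<close>. The
    three sums are then at most \<open>6.5 ?r\<close>, \<open>9 ?r^2\<close> and
    \<open>8.5 ?r\<close>.\<close>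
  have y1: "\<bar>y\<bar> \<le> 7 * ?r" and y2: "\<bar>y + 2 * Re z\<bar> \<le> 9 * ?r\<^sup>2" and y3: "\<bar>y - 2 * Re z\<bar> \<le> 9 * ?r"
    unfolding y using z1 z2 e1 r2 r3 by linarith+
  have y4: "\<bar>y\<^sup>2 - 4 * (Re z)\<^sup>2\<bar> \<le> 81 * ?r ^ 3"
  proof -
    have "\<bar>y\<^sup>2 - 4 * (Re z)\<^sup>2\<bar> = \<bar>y + 2 * Re z\<bar> * \<bar>y - 2 * Re z\<bar>"
      by (simp add: abs_mult[symmetric] power2_eq_square algebra_simps)
    also have "\<dots> \<le> (9 * ?r\<^sup>2) * (9 * ?r)" by (intro mult_mono y2 y3) auto
    also have "\<dots> = 81 * ?r ^ 3" by (simp add: power2_eq_square power3_eq_cube)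
    finally show ?thesis .
  qed
  have w: "mellin_kernel k \<tau> (cmod (1 - z)) = exp (a * of_real y)"
    using nz by (simp add: mellin_kernel_eq_exp y_def a_def)
  have "cmod (exp (a * of_real y) - (\<Sum>i\<le>2. (a * of_real y) ^ i / fact i))
      \<le> exp (cmod (a * of_real y)) * cmod (a * of_real y) ^ Suc 2 / fact 2"
    by (rule Taylor_exp_field)
  also have "\<dots> \<le> exp (K * 4) * (K * (7 * ?r)) ^ 3"
  proof -
    have ay: "cmod (a * of_real y) \<le> K * (7 * ?r)"
      unfolding norm_mult norm_of_real using a y1 K by (intro mult_mono) auto
    also have "\<dots> \<le> K * 4" using r K by (intro mult_left_mono) auto
    finally have "exp (cmod (a * of_real y)) * cmod (a * of_real y) ^ 3 \<le> exp (K * 4) * (K * (7 * ?r)) ^ 3"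
      using ay by (intro mult_mono power_mono) auto
    moreover have "0 \<le> exp (cmod (a * of_real y)) * cmod (a * of_real y) ^ 3" by simp
    moreover have "exp (cmod (a * of_real y)) * cmod (a * of_real y) ^ Suc 2 / fact 2
        = exp (cmod (a * of_real y)) * cmod (a * of_real y) ^ 3 / 2" by simp
    ultimately show ?thesis by linarith
  qed
  finally have 1: "cmod (exp (a * of_real y) - (\<Sum>i\<le>2. (a * of_real y) ^ i / fact i)) \<le> exp (K * 4) * (K * 7) ^ 3 * ?r ^ 3"
    by (simp add: power_mult_distrib)
  have "mellin_kernel k \<tau> (cmod (1 - z)) - mellin_quadratic a z
     = (exp (a * of_real y) - (\<Sum>i\<le>2. (a * of_real y) ^ i / fact i))
     + (a * of_real (2 * Re e) + a\<^sup>2 / 2 * of_real (y\<^sup>2 - 4 * (Re z)\<^sup>2))"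
  proof -
    have "(\<Sum>i\<le>2. (a * of_real y) ^ i / fact i) = 1 + a * of_real y + a\<^sup>2 * of_real (y\<^sup>2) / 2"
      by (simp add: eval_nat_numeral)
    moreover have "2 * Re e = y + (2 * Re z + Re (z\<^sup>2))" by (simp add: y)
    ultimately show ?thesis
      unfolding w mellin_quadratic_def by (simp only:) (simp add: algebra_simps)
  qed
  moreover have "cmod (a * of_real (2 * Re e)) \<le> K * (16 * ?r ^ 3)"
    unfolding norm_mult norm_of_real using a e1 K by (intro mult_mono) auto
  moreover have "cmod (a\<^sup>2 / 2 * of_real (y\<^sup>2 - 4 * (Re z)\<^sup>2)) \<le> K\<^sup>2 * (81 * ?r ^ 3)"
    unfolding norm_mult norm_of_real
  proof (intro mult_mono y4)
    have "cmod (a\<^sup>2 / 2) \<le> (cmod a)\<^sup>2" by (simp add: norm_power norm_divide)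
    also have "\<dots> \<le> K\<^sup>2" using a by (intro power_mono) auto
    finally show "cmod (a\<^sup>2 / 2) \<le> K\<^sup>2" .
  qed auto
  moreover note 1
  ultimately have "cmod (mellin_kernel k \<tau> (cmod (1 - z)) - mellin_quadratic a z)
     \<le> exp (K * 4) * (K * 7) ^ 3 * ?r ^ 3 + (K * (16 * ?r ^ 3) + K\<^sup>2 * (81 * ?r ^ 3))"
    by (smt (verit) norm_triangle_ineq)
  then show ?thesis by (simp add: algebra_simps)
qed

lemma norm_mellin_quadratic:
  assumes "cmod a \<le> K" "cmod z \<le> 1"
  shows "cmod (mellin_quadratic a z) \<le> 1 + K * 3 + 2 * K\<^sup>2"
proof -
  have K: "K \<ge> 0" using assms(1) norm_ge_zero order_trans by blast
  have z: "\<bar>Re z\<bar> \<le> 1" "\<bar>Re (z\<^sup>2)\<bar> \<le> 1"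
    using assms(2) abs_Re_le_cmod[of z] abs_Re_le_cmod[of "z\<^sup>2"] power_le_one[of "cmod z" 2]
    by (auto simp: norm_power)
  have "cmod (a * of_real (2 * Re z + Re (z\<^sup>2))) \<le> K * 3"
    unfolding norm_mult norm_of_real using assms(1) z K by (intro mult_mono) auto
  moreover have "cmod (2 * a\<^sup>2 * of_real ((Re z)\<^sup>2)) \<le> 2 * K\<^sup>2 * 1"
    unfolding norm_mult norm_of_real using assms(1) z K
    by (intro mult_mono) (auto simp: norm_power abs_square_le_1 intro!: power_mono)
  moreover have "cmod (mellin_quadratic a z) \<le> cmod (1 - a * of_real (2 * Re z + Re (z\<^sup>2))) + cmod (2 * a\<^sup>2 * of_real ((Re z)\<^sup>2))"
    unfolding mellin_quadratic_def by (rule norm_triangle_ineq)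
  moreover have "cmod (1 - a * of_real (2 * Re z + Re (z\<^sup>2))) \<le> 1 + cmod (a * of_real (2 * Re z + Re (z\<^sup>2)))"
    using norm_triangle_ineq4[of 1 "a * of_real (2 * Re z + Re (z\<^sup>2))"] by simp
  ultimately show ?thesis by linarith
qed

lemma norm_one_minus_le_2: "cmod z \<le> 1 \<Longrightarrow> cmod (1 - z) \<le> 2"
  using norm_triangle_ineq4[of 1 z] by simp

lemma norm_mellin_kernel_le:
  assumes "cmod z \<le> 1"
  shows "cmod (mellin_kernel k \<tau> (cmod (1 - z))) \<le> 2 ^ (2 * k)"
proof -
  have "cmod (mellin_kernel k \<tau> (cmod (1 - z))) \<le> cmod (1 - z) ^ (2 * k)"
    by (rule norm_mellin_kernel) simp
  also have "\<dots> \<le> 2 ^ (2 * k)" using norm_one_minus_le_2[OF assms] by (intro power_mono) auto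
  finally show ?thesis .
qed

text \<open>The expansion is valid only away from the singularity \<open>z = 1\<close>. Outside the
  half disc both terms are merely bounded, but there a constant is itself at most a multiple of
  \<open>cmod z ^ 3\<close>. The bound is uniform in \<open>\<tau>\<close>, which is what the
  varying frequency requires.\<close>

lemma mellin_kernel_taylor:
  obtains C where "C \<ge> 0" "\<And>(\<tau>::real) z. \<bar>\<tau>\<bar> \<le> 1 \<Longrightarrow> cmod z \<le> 1 \<Longrightarrow>
    cmod (mellin_kernel k \<tau> (cmod (1 - z)) - mellin_quadratic (mellin_exponent k \<tau>) z) \<le> C * cmod z ^ 3"
proof
  define K where "K = real k + 1"
  define C1 where "C1 = exp (K * 4) * (K * 7) ^ 3 + K * 16 + K\<^sup>2 * 81"
  \<comment> \<open>The 8 comes from \<open>1 \<le> 8 * cmod z ^ 3\<close> for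
    \<open>cmod z > 1/2\<close>; the bracket adds the crude bounds of the kernel and of the
    quadratic polynomial.\<close>
  define C2 where "C2 = 8 * (2 ^ (2 * k) + (1 + K * 3 + 2 * K\<^sup>2))"
  have C: "C1 \<ge> 0" "C2 \<ge> 0" by (auto simp: C1_def C2_def K_def)
  then show "C1 + C2 \<ge> 0" by simp
  fix \<tau> :: real and z assume tau: "\<bar>\<tau>\<bar> \<le> 1" and z: "cmod z \<le> 1"
  let ?d = "cmod (mellin_kernel k \<tau> (cmod (1 - z)) - mellin_quadratic (mellin_exponent k \<tau>) z)"
  show "?d \<le> (C1 + C2) * cmod z ^ 3"
  proof (cases "cmod z \<le> 1/2")
    case True
    have "?d \<le> C1 * cmod z ^ 3"
      using mellin_kernel_near[OF tau True, of k] by (simp only: C1_def K_def)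
    also have "\<dots> \<le> (C1 + C2) * cmod z ^ 3" using C by (intro mult_right_mono) auto
    finally show ?thesis .
  next
    case False
    then have "(1/2) ^ 3 \<le> cmod z ^ 3" by (intro power_mono) auto
    then have r: "1 \<le> 8 * cmod z ^ 3" by (simp add: power_divide)
    have "?d \<le> 2 ^ (2 * k) + (1 + K * 3 + 2 * K\<^sup>2)"
      using norm_mellin_kernel_le[OF z, of k \<tau>] norm_mellin_quadratic[OF norm_mellin_exponent[OF tau] z, of k]
        norm_triangle_ineq4[of "mellin_kernel k \<tau> (cmod (1 - z))" "mellin_quadratic (mellin_exponent k \<tau>) z"]
      unfolding K_def by linarith
    also have "\<dots> \<le> (2 ^ (2 * k) + (1 + K * 3 + 2 * K\<^sup>2)) * (8 * cmod z ^ 3)"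
      using mult_left_mono[OF r, of "2 ^ (2 * k) + (1 + K * 3 + 2 * K\<^sup>2)"] by (simp add: K_def)
    also have "\<dots> = C2 * cmod z ^ 3" by (simp add: C2_def)
    also have "\<dots> \<le> (C1 + C2) * cmod z ^ 3" using C by (intro mult_right_mono) auto
    finally show ?thesis .
  qed
qed

text \<open>Index \<open>n\<close> belongs to the step from dimension \<open>n\<close> to
  \<open>n + 1\<close>, so the \<open>1 / j\<close> of the overview appears as
  \<open>1 / of_nat (Suc n)\<close>.\<close>

definition factor_mellin :: "nat \<Rightarrow> real \<Rightarrow> nat \<Rightarrow> complex" where
  "factor_mellin k \<tau> n = (\<integral>v. mellin_kernel k \<tau> (cmod (1 - v n)) \<partial>sphere_law (Suc n))"

lemma measurable_factor [measurable]:
  "(\<lambda>v. mellin_kernel k \<tau> (cmod (1 - v n))) \<in> borel_measurable (sphere_law (Suc n))"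
  by measurable

lemma integrable_factor: "integrable (sphere_law (Suc n)) (\<lambda>v. mellin_kernel k \<tau> (cmod (1 - v n)))"
  by (rule sphere_integrableI[where C="2 ^ (2 * k)"]) (auto intro: norm_mellin_kernel_le sphere_coordinate_le_1)

text \<open>Since \<open>2 (Re z)^2 = Re (z^2) + (cmod z)^2\<close>, the polynomial is a combination
  of \<open>Re z\<close>, \<open>Re (z^2)\<close> and \<open>(cmod z)^2\<close>. The first two have
  mean 0 and the last has mean \<open>1 / (n + 1)\<close>.\<close>

lemma integral_mellin_quadratic:
  "(\<integral>v. mellin_quadratic a (v n) \<partial>sphere_law (Suc n)) = 1 + a\<^sup>2 / of_nat (Suc n)"
proof -
  let ?S = "sphere_law (Suc n)"
  interpret S: prob_space ?S by (rule prob_space_sphere_law) simp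
  have i1: "integrable ?S (\<lambda>v. v n)" and i2: "integrable ?S (\<lambda>v. (v n)\<^sup>2)" and i3: "integrable ?S (\<lambda>v. (cmod (v n))\<^sup>2)"
    by (rule sphere_integrableI[where C=1]; auto simp: sphere_coordinate_le_1 norm_power power_le_one)+
  have eq: "mellin_quadratic a z = 1 - 2 * a * of_real (Re z) + (a\<^sup>2 - a) * of_real (Re (z\<^sup>2)) + a\<^sup>2 * of_real ((cmod z)\<^sup>2)" for z
    unfolding mellin_quadratic_def cmod_power2 by (simp add: power2_eq_square algebra_simps)
  have "(\<integral>v. mellin_quadratic a (v n) \<partial>?S) = 1 - 2 * a * of_real (\<integral>v. Re (v n) \<partial>?S)
      + (a\<^sup>2 - a) * of_real (\<integral>v. Re ((v n)\<^sup>2) \<partial>?S) + a\<^sup>2 * of_real (\<integral>v. (cmod (v n))\<^sup>2 \<partial>?S)"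
  proof -
    have lin: "(\<integral>v. 1 - 2 * a * of_real (f v) + (a\<^sup>2 - a) * of_real (g v) + a\<^sup>2 * of_real (h v) \<partial>?S)
        = 1 - 2 * a * of_real (\<integral>v. f v \<partial>?S) + (a\<^sup>2 - a) * of_real (\<integral>v. g v \<partial>?S) + a\<^sup>2 * of_real (\<integral>v. h v \<partial>?S)"
      if "integrable ?S f" "integrable ?S g" "integrable ?S h" for f g h :: "_ \<Rightarrow> real"
      using that by (simp add: S.prob_space)
    show ?thesis
      unfolding eq by (rule lin[OF integrable_Re[OF i1] integrable_Re[OF i2] i3])
  qed
  also have "(\<integral>v. Re (v n) \<partial>?S) = 0"
    using integral_Re[OF i1] by (simp add: sphere_coordinate_mean)
  also have "(\<integral>v. Re ((v n)\<^sup>2) \<partial>?S) = 0"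
    by (subst integral_Re[OF i2]) (simp add: sphere_coordinate_square)
  finally show ?thesis by (simp add: sphere_coordinate_moment2)
qed

text \<open>The odd moment is interpolated between the even ones by
  \<open>t^3 \<le> t^2 / (2 q) + q t^4 / 2\<close>. The weight \<open>q = sqrt (n + 1)\<close>
  balances the two terms, the second and fourth moments being of order \<open>1 / (n + 1)\<close>
  and its square.\<close>

lemma sphere_coordinate_moment3:
  "(\<integral>v. cmod (v n) ^ 3 \<partial>sphere_law (Suc n)) \<le> 2 * real (Suc n) powr (-3/2)"
proof -
  let ?S = "sphere_law (Suc n)" and ?N = "real (Suc n)"
  define q where "q = sqrt ?N"
  have q: "q > 0" "q * q = ?N" by (simp_all add: q_def)
  have i: "integrable ?S (\<lambda>v. cmod (v n) ^ m)" for m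
    by (rule sphere_integrableI[where C=1]) (auto simp: sphere_coordinate_le_1 power_le_one)
  have "(\<integral>v. cmod (v n) ^ 3 \<partial>?S) \<le> (\<integral>v. (cmod (v n))\<^sup>2 / (2 * q) + q / 2 * cmod (v n) ^ 4 \<partial>?S)"
  proof (intro integral_mono i Bochner_Integration.integrable_add integrable_divide integrable_mult_right)
    fix v :: "nat \<Rightarrow> complex"
    let ?t = "cmod (v n)"
    have "0 \<le> ?t\<^sup>2 * (1 - q * ?t)\<^sup>2 / (2 * q)" using q by simp
    also have "\<dots> = ?t\<^sup>2 / (2 * q) + q / 2 * ?t ^ 4 - ?t ^ 3"
      using q by (simp add: field_simps power2_eq_square power3_eq_cube power4_eq_xxxx)
    finally show "?t ^ 3 \<le> ?t\<^sup>2 / (2 * q) + q / 2 * ?t ^ 4" by simp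
  qed
  also have "\<dots> = (1 / ?N) / (2 * q) + q / 2 * (2 / (?N * real (Suc (Suc n))))"
    using i by (simp add: sphere_coordinate_moment2 sphere_coordinate_moment4 del: of_nat_Suc)
  also have "\<dots> \<le> 1 / (?N * q) + q / (?N * ?N)"
  proof (rule add_mono)
    have "1 / ?N / (2 * q) = 1 / (?N * (2 * q))" by simp
    also have "\<dots> \<le> 1 / (?N * q)" using q by (intro divide_left_mono mult_left_mono mult_pos_pos) auto
    finally show "1 / ?N / (2 * q) \<le> 1 / (?N * q)" .
    have "q / 2 * (2 / (?N * real (Suc (Suc n)))) = q / (?N * real (Suc (Suc n)))" by simp
    also have "\<dots> \<le> q / (?N * ?N)" using q by (intro divide_left_mono mult_left_mono mult_pos_pos) auto
    finally show "q / 2 * (2 / (?N * real (Suc (Suc n)))) \<le> q / (?N * ?N)" .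
  qed
  also have "q / (?N * ?N) = 1 / (?N * q)" using q(1) unfolding q(2)[symmetric] by (simp add: field_simps)
  also have "1 / (?N * q) = ?N powr (-3/2)"
  proof -
    have "?N powr (-3/2) = ?N powr (- 1) * ?N powr (- (1/2))" by (subst powr_add[symmetric]) simp
    then show ?thesis by (simp add: q_def powr_minus powr_half_sqrt field_simps)
  qed
  finally show ?thesis by simp
qed

lemma factor_mellin_approx:
  obtains C where "C \<ge> 0" "\<And>(\<tau>::real) n. \<bar>\<tau>\<bar> \<le> 1 \<Longrightarrow>
    cmod (factor_mellin k \<tau> n - (1 + (mellin_exponent k \<tau>)\<^sup>2 / of_nat (Suc n))) \<le> C * real (Suc n) powr (-3/2)"
proof -
  obtain C where C: "C \<ge> 0" "\<And>(\<tau>::real) z. \<bar>\<tau>\<bar> \<le> 1 \<Longrightarrow> cmod z \<le> 1 \<Longrightarrow>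
    cmod (mellin_kernel k \<tau> (cmod (1 - z)) - mellin_quadratic (mellin_exponent k \<tau>) z) \<le> C * cmod z ^ 3"
    using mellin_kernel_taylor[of k] by blast
  have "cmod (factor_mellin k \<tau> n - (1 + (mellin_exponent k \<tau>)\<^sup>2 / of_nat (Suc n))) \<le> 2 * C * real (Suc n) powr (-3/2)"
    if tau: "\<bar>\<tau>\<bar> \<le> 1" for \<tau> n
  proof -
    let ?S = "sphere_law (Suc n)" and ?a = "mellin_exponent k \<tau>"
    have [measurable]: "(\<lambda>v. mellin_quadratic ?a (v n)) \<in> borel_measurable ?S"
      unfolding mellin_quadratic_def by measurable
    have iq: "integrable ?S (\<lambda>v. mellin_quadratic ?a (v n))"
      by (rule sphere_integrableI) (auto intro: norm_mellin_quadratic[OF order_refl] sphere_coordinate_le_1)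
    have i3: "integrable ?S (\<lambda>v. C * cmod (v n) ^ 3)"
      by (rule integrable_mult_right, rule sphere_integrableI[where C=1]) (auto simp: sphere_coordinate_le_1 power_le_one)
    have "factor_mellin k \<tau> n - (1 + ?a\<^sup>2 / of_nat (Suc n))
        = (\<integral>v. mellin_kernel k \<tau> (cmod (1 - v n)) - mellin_quadratic ?a (v n) \<partial>?S)"
      unfolding factor_mellin_def integral_mellin_quadratic[symmetric]
      by (rule Bochner_Integration.integral_diff[symmetric, OF integrable_factor iq])
    also have "cmod \<dots> \<le> (\<integral>v. cmod (mellin_kernel k \<tau> (cmod (1 - v n)) - mellin_quadratic ?a (v n)) \<partial>?S)"
      by (rule integral_norm_bound)
    also have "\<dots> \<le> (\<integral>v. C * cmod (v n) ^ 3 \<partial>?S)"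
      by (rule integral_mono[OF integrable_norm[OF Bochner_Integration.integrable_diff[OF integrable_factor iq]] i3])
        (auto simp: space_sphere_law intro!: C(2) tau sphere_coordinate_le_1)
    also have "\<dots> = C * (\<integral>v. cmod (v n) ^ 3 \<partial>?S)" by simp
    also have "\<dots> \<le> C * (2 * real (Suc n) powr (-3/2))"
      by (intro mult_left_mono sphere_coordinate_moment3 C)
    finally show ?thesis by (simp only: mult_ac)
  qed
  with C(1) that[of "2 * C"] show ?thesis by simp
qed

lemma factor_mellin_tendsto:
  assumes "\<tau> \<longlonglongrightarrow> 0"
  shows "(\<lambda>m. factor_mellin k (\<tau> m) n) \<longlonglongrightarrow> factor_mellin k 0 n"
  unfolding factor_mellin_def
proof (rule integral_dominated_convergence[where w="\<lambda>_. 2 ^ (2 * k)"])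
  interpret S: prob_space "sphere_law (Suc n)" by (rule prob_space_sphere_law) simp
  show "integrable (sphere_law (Suc n)) (\<lambda>_. 2 ^ (2 * k) :: real)" by simp
  have "(\<lambda>m. mellin_kernel k (\<tau> m) x) \<longlonglongrightarrow> mellin_kernel k 0 x" for x
    unfolding mellin_kernel_def cis_conv_exp
    by (cases "x = 0") (auto intro!: tendsto_eq_intros assms)
  then show "AE v in sphere_law (Suc n). (\<lambda>m. mellin_kernel k (\<tau> m) (cmod (1 - v n))) \<longlonglongrightarrow> mellin_kernel k 0 (cmod (1 - v n))"
    by simp
  show "AE v in sphere_law (Suc n). cmod (mellin_kernel k (\<tau> m) (cmod (1 - v n))) \<le> 2 ^ (2 * k)" for m
    by (rule AE_I2) (auto simp: space_sphere_law intro!: norm_mellin_kernel_le sphere_coordinate_le_1)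
qed (rule measurable_factor)+

text \<open>The integrand at \<open>\<tau> = 0\<close> is real, nonnegative and zero only on the
  null event \<open>v n = 1\<close>. Strict positivity licenses the later divisions by these
  factors.\<close>

lemma factor_mellin_0: "\<exists>x>0. factor_mellin k 0 n = complex_of_real x"
proof -
  let ?S = "sphere_law (Suc n)"
  interpret S: prob_space ?S by (rule prob_space_sphere_law) simp
  define f where "f v = (if v n = 1 then 0 else cmod (1 - v n) ^ (2 * k))" for v :: "nat \<Rightarrow> complex"
  have kf: "mellin_kernel k 0 (cmod (1 - v n)) = complex_of_real (f v)" for v
    by (auto simp: mellin_kernel_def f_def)
  have int: "integrable ?S f"
    using integrable_factor[of n k 0] unfolding kf by (simp only: complex_of_real_integrable_eq)
  have "(\<integral>v. f v \<partial>?S) \<noteq> 0"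
  proof
    assume "(\<integral>v. f v \<partial>?S) = 0"
    then have "AE v in ?S. f v = 0"
      by (subst (asm) integral_nonneg_eq_0_iff_AE[OF int]) (auto simp: f_def)
    then have "AE v in ?S. False"
      using sphere_coordinate_ne_1[of n] by eventually_elim (auto simp: f_def)
    then show False by simp
  qed
  moreover have "(\<integral>v. f v \<partial>?S) \<ge> 0" by (rule integral_nonneg_AE) (auto simp: f_def)
  ultimately show ?thesis
    unfolding factor_mellin_def kf integral_complex_of_real by (intro exI[of _ "\<integral>v. f v \<partial>?S"]) auto
qed


subsection \<open>Mellin transform of the characteristic polynomial\<close>

lemma measurable_charpoly: "(\<lambda>U. charpoly_Z N U \<theta>) \<in> borel_measurable borel"
proof -
  let ?c = "exp (- \<i> * complex_of_real \<theta>)"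
  have [measurable]: "(\<lambda>U::nat \<times> nat \<Rightarrow> complex. U p) \<in> borel_measurable borel" for p
    by (rule measurable_coordinate[OF measurable_ident[unfolded id_def]])
  have "charpoly_Z N U \<theta> = (\<Sum>p | p permutes {0..<N}. signof p *
      (\<Prod>i = 0..<N. (if i = p i then 1 else 0) - U (i, p i) * ?c))" for U
    unfolding charpoly_Z_def
    by (subst det_def'[of _ N]) (auto intro!: sum.cong prod.cong arg_cong2[where f="(*)"] dest: permutes_in_image)
  then show ?thesis by simp
qed

lemma charpoly_haar [measurable]: "(\<lambda>U. charpoly_Z N U \<theta>) \<in> borel_measurable (haar N)"
  by (rule measurable_compose[OF measurable_ident_restrict[OF left_invariant_probD(1)[OF left_invariant_prob_haar]] measurable_charpoly])

lemma haar_integral_rotate: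
  fixes f :: "complex \<Rightarrow> 'b :: {banach, second_countable_topology}"
  assumes f: "f \<in> borel_measurable borel"
  shows "(\<integral>U. f (charpoly_Z N U \<theta>) \<partial>haar N) = (\<integral>U. f (charpoly_Z N U 0) \<partial>haar N)"
    "integrable (haar N) (\<lambda>U. f (charpoly_Z N U \<theta>)) \<longleftrightarrow> integrable (haar N) (\<lambda>U. f (charpoly_Z N U 0))"
proof -
  let ?V = "\<lambda>p. exp (- \<i> * complex_of_real \<theta>) * mat_id N p"
  note inv = left_invariant_prob_haar[of N]
  have V: "?V \<in> unitary_group N" by (rule scalar_unitary(1)) (simp add: norm_exp_eq_Re)
  have Vm: "mat_mult N ?V \<in> measurable (haar N) (haar N)" by (rule left_invariant_probD(4)[OF inv V])
  have d: "distr (haar N) (haar N) (mat_mult N ?V) = haar N"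
    using inv V unfolding left_invariant_prob_def by blast
  have eq: "f (charpoly_Z N U \<theta>) = f (charpoly_Z N (mat_mult N ?V U) 0)" if "U \<in> space (haar N)" for U
    using that by (subst charpoly_Z_rotate) (simp_all add: left_invariant_probD(3)[OF inv])
  have m: "(\<lambda>U. f (charpoly_Z N U 0)) \<in> borel_measurable (haar N)"
    by (rule measurable_compose[OF charpoly_haar f])
  show "(\<integral>U. f (charpoly_Z N U \<theta>) \<partial>haar N) = (\<integral>U. f (charpoly_Z N U 0) \<partial>haar N)"
    (is "?l = ?r")
  proof -
    have "?l = (\<integral>U. f (charpoly_Z N (mat_mult N ?V U) 0) \<partial>haar N)"
      by (rule Bochner_Integration.integral_cong[OF refl eq])
    also have "\<dots> = (\<integral>U. f (charpoly_Z N U 0) \<partial>distr (haar N) (haar N) (mat_mult N ?V))"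
      by (rule integral_distr[OF Vm m, symmetric])
    finally show ?thesis by (simp only: d)
  qed
  show "integrable (haar N) (\<lambda>U. f (charpoly_Z N U \<theta>)) \<longleftrightarrow> integrable (haar N) (\<lambda>U. f (charpoly_Z N U 0))"
    (is "?l \<longleftrightarrow> ?r")
  proof -
    have "?l \<longleftrightarrow> integrable (haar N) (\<lambda>U. f (charpoly_Z N (mat_mult N ?V U) 0))"
      by (rule Bochner_Integration.integrable_cong[OF refl eq])
    also have "\<dots> \<longleftrightarrow> integrable (distr (haar N) (haar N) (mat_mult N ?V)) (\<lambda>U. f (charpoly_Z N U 0))"
      by (rule integrable_distr_eq[OF Vm m, symmetric])
    finally show ?thesis by (simp only: d)
  qed
qed

text \<open>Integrability travels with the value through the induction, since it is what Fubini's
  theorem consumes in the next step.\<close>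

lemma haar_mellin_0:
  "integrable (haar N) (\<lambda>U. mellin_kernel k \<tau> (cmod (charpoly_Z N U 0))) \<and>
   (\<integral>U. mellin_kernel k \<tau> (cmod (charpoly_Z N U 0)) \<partial>haar N) = (\<Prod>n<N. factor_mellin k \<tau> n)"
proof (induction N)
  case 0
  interpret H: prob_space "haar 0" by (rule left_invariant_probD[OF left_invariant_prob_haar])
  have "mellin_kernel k \<tau> (cmod (charpoly_Z 0 U 0)) = 1" for U
    by (simp add: charpoly_Z_def mellin_kernel_def)
  then show ?case by (simp add: H.prob_space)
next
  case (Suc n)
  let ?S = "sphere_law (Suc n)" and ?H = "haar n"
  let ?g = "\<lambda>U. mellin_kernel k \<tau> (cmod (charpoly_Z n U 0))"
  let ?h = "\<lambda>v. mellin_kernel k \<tau> (cmod (1 - v n))"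
  let ?G = "\<lambda>U. mellin_kernel k \<tau> (cmod (charpoly_Z (Suc n) U 0))"
  note inv = left_invariant_prob_haar[of n]
  interpret S: prob_space ?S by (rule prob_space_sphere_law) simp
  interpret H: prob_space ?H by (rule left_invariant_probD[OF inv])
  interpret P: pair_sigma_finite ?S ?H ..
  have am: "assemble n \<in> measurable (?S \<Otimes>\<^sub>M ?H) (unitary_space (Suc n))"
    by (rule measurable_assemble[OF left_invariant_probD(1)[OF inv]])
  have Gm: "?G \<in> borel_measurable (unitary_space (Suc n))"
  proof -
    have "(\<lambda>z. mellin_kernel k \<tau> (cmod z)) \<in> borel_measurable borel" by measurable
    from measurable_compose[OF measurable_compose[OF measurable_ident_restrict[OF refl] measurable_charpoly] this]
    show ?thesis .
  qed
  have eq: "?G (assemble n (v, W)) = ?h v * ?g W" if "v \<in> space ?S" "W \<in> space ?H" for v W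
  proof -
    have "charpoly_Z (Suc n) (assemble n (v, W)) 0 = (1 - v n) * charpoly_Z n W 0"
      using that unfolding assemble_def prod.case
      by (intro charpoly_reflection_extend) (simp_all add: space_sphere_law left_invariant_probD(3)[OF inv])
    then show ?thesis by (simp add: norm_mult mellin_kernel_mult)
  qed
  have eq': "?G (assemble n p) = (case p of (v, W) \<Rightarrow> ?h v * ?g W)" if "p \<in> space (?S \<Otimes>\<^sub>M ?H)" for p
    using that eq by (cases p) (auto simp: space_pair_measure)
  have IH: "integrable ?H ?g" "(\<integral>U. ?g U \<partial>?H) = (\<Prod>n<n. factor_mellin k \<tau> n)"
    using Suc by auto
  have hm: "?h \<in> borel_measurable ?S" and gm: "?g \<in> borel_measurable ?H" by measurable
  have pm: "(\<lambda>(v, W). ?h v * ?g W) \<in> borel_measurable (?S \<Otimes>\<^sub>M ?H)"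
    using borel_measurable_times[OF measurable_compose[OF measurable_fst hm, of ?H] measurable_compose[OF measurable_snd gm, of ?S]]
    by (simp add: case_prod_beta)
  have pint: "integrable (?S \<Otimes>\<^sub>M ?H) (\<lambda>(v, W). ?h v * ?g W)"
  proof (rule P.Fubini_integrable[OF pm])
    have "integrable ?S (\<lambda>v. norm (?h v) * (\<integral>W. norm (?g W) \<partial>?H))"
      by (intro integrable_mult_left integrable_norm integrable_factor)
    then show "integrable ?S (\<lambda>v. \<integral>W. norm (case (v, W) of (v, W) \<Rightarrow> ?h v * ?g W) \<partial>?H)"
      by (simp add: norm_mult)
    show "AE v in ?S. integrable ?H (\<lambda>W. case (v, W) of (v, W) \<Rightarrow> ?h v * ?g W)"
      using IH(1) by simp
  qed
  have "integrable (haar (Suc n)) ?G \<longleftrightarrow> integrable (?S \<Otimes>\<^sub>M ?H) (\<lambda>p. ?G (assemble n p))"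
    unfolding haar_Suc by (rule integrable_distr_eq[OF am Gm])
  also have "\<dots> \<longleftrightarrow> integrable (?S \<Otimes>\<^sub>M ?H) (\<lambda>(v, W). ?h v * ?g W)"
    by (rule Bochner_Integration.integrable_cong[OF refl eq'])
  finally have 1: "integrable (haar (Suc n)) ?G" using pint by simp
  have "(\<integral>U. ?G U \<partial>haar (Suc n)) = (\<integral>p. ?G (assemble n p) \<partial>(?S \<Otimes>\<^sub>M ?H))"
    unfolding haar_Suc by (rule integral_distr[OF am Gm])
  also have "\<dots> = (\<integral>p. (case p of (v, W) \<Rightarrow> ?h v * ?g W) \<partial>(?S \<Otimes>\<^sub>M ?H))"
    by (rule Bochner_Integration.integral_cong[OF refl eq'])
  also have "\<dots> = (\<integral>v. (\<integral>W. ?h v * ?g W \<partial>?H) \<partial>?S)"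
    using P.integral_fst'[OF pint] by simp
  also have "\<dots> = factor_mellin k \<tau> n * (\<integral>W. ?g W \<partial>?H)"
    by (simp add: factor_mellin_def)
  finally show ?case using 1 IH(2) by (simp add: mult.commute)
qed

lemma haar_mellin:
  "integrable (haar N) (\<lambda>U. mellin_kernel k \<tau> (cmod (charpoly_Z N U \<theta>)))"
  "(\<integral>U. mellin_kernel k \<tau> (cmod (charpoly_Z N U \<theta>)) \<partial>haar N) = (\<Prod>n<N. factor_mellin k \<tau> n)"
proof -
  have "(\<lambda>z. mellin_kernel k \<tau> (cmod z)) \<in> borel_measurable borel" by measurable
  note rot = haar_integral_rotate[OF this, where \<theta>=\<theta> and N=N]
  show "integrable (haar N) (\<lambda>U. mellin_kernel k \<tau> (cmod (charpoly_Z N U \<theta>)))"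
    "(\<integral>U. mellin_kernel k \<tau> (cmod (charpoly_Z N U \<theta>)) \<partial>haar N) = (\<Prod>n<N. factor_mellin k \<tau> n)"
    using rot haar_mellin_0[of N k \<tau>] by simp_all
qed

text \<open>With \<open>k = 0\<close> and \<open>\<tau> = 0\<close> the kernel is the indicator of a
  nonzero determinant, and each factor of its expectation is 1 because \<open>v n \<noteq> 1\<close>
  almost surely.\<close>

lemma haar_charpoly_nonzero: "AE U in haar N. charpoly_Z N U \<theta> \<noteq> 0"
proof -
  interpret H: prob_space "haar N" by (rule left_invariant_probD[OF left_invariant_prob_haar])
  have "factor_mellin 0 0 n = 1" for n
  proof -
    interpret S: prob_space "sphere_law (Suc n)" by (rule prob_space_sphere_law) simp
    have "factor_mellin 0 0 n = (\<integral>v. 1 \<partial>sphere_law (Suc n))"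
      unfolding factor_mellin_def
      by (rule integral_cong_AE[OF measurable_factor borel_measurable_const])
        (use sphere_coordinate_ne_1[of n] in \<open>auto simp: mellin_kernel_def\<close>)
    then show ?thesis by (simp add: S.prob_space)
  qed
  then have one: "(\<integral>U. mellin_kernel 0 0 (cmod (charpoly_Z N U \<theta>)) \<partial>haar N) = 1"
    by (simp add: haar_mellin)
  let ?A = "{U \<in> space (haar N). charpoly_Z N U \<theta> \<noteq> 0}"
  have A: "?A \<in> sets (haar N)" by measurable
  have "complex_of_real (measure (haar N) ?A) = (\<integral>U. complex_of_real (indicator ?A U) \<partial>haar N)"
    using A by simp
  also have "\<dots> = (\<integral>U. mellin_kernel 0 0 (cmod (charpoly_Z N U \<theta>)) \<partial>haar N)"
    by (rule Bochner_Integration.integral_cong) (auto simp: mellin_kernel_def)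
  finally have "measure (haar N) ?A = 1" unfolding one by simp
  then show ?thesis by (subst (asm) H.prob_Collect_eq_1) measurable
qed

text \<open>Identifies the normalising constant of the tilt with the product of factors at
  \<open>\<tau> = 0\<close>. For \<open>k = 0\<close> the kernel and the power differ at a zero
  determinant, hence the almost-everywhere argument.\<close>

lemma haar_moment:
  obtains m where "m > 0" "integrable (haar N) (\<lambda>U. cmod (charpoly_Z N U \<theta>) ^ (2 * k))"
    "(\<integral>U. cmod (charpoly_Z N U \<theta>) ^ (2 * k) \<partial>haar N) = m" "(\<Prod>n<N. factor_mellin k 0 n) = complex_of_real m"
proof -
  obtain x where x: "\<And>n. x n > 0" "\<And>n. factor_mellin k 0 n = complex_of_real (x n)"
    using factor_mellin_0[of k] by metis
  have ae: "AE U in haar N. mellin_kernel k 0 (cmod (charpoly_Z N U \<theta>)) = complex_of_real (cmod (charpoly_Z N U \<theta>) ^ (2 * k))"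
    using haar_charpoly_nonzero[of N \<theta>] by eventually_elim (simp add: mellin_kernel_def)
  have "integrable (haar N) (\<lambda>U. complex_of_real (cmod (charpoly_Z N U \<theta>) ^ (2 * k)))"
    using haar_mellin(1)[of N k 0 \<theta>] by (subst (asm) integrable_cong_AE[OF _ _ ae]) auto
  then have 1: "integrable (haar N) (\<lambda>U. cmod (charpoly_Z N U \<theta>) ^ (2 * k))"
    by (simp only: complex_of_real_integrable_eq)
  have "complex_of_real (\<integral>U. cmod (charpoly_Z N U \<theta>) ^ (2 * k) \<partial>haar N)
      = (\<integral>U. mellin_kernel k 0 (cmod (charpoly_Z N U \<theta>)) \<partial>haar N)"
    unfolding integral_complex_of_real[symmetric]
    by (rule integral_cong_AE) (use ae in auto)
  also have "\<dots> = complex_of_real (\<Prod>n<N. x n)" by (simp add: haar_mellin x(2))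
  finally have "(\<integral>U. cmod (charpoly_Z N U \<theta>) ^ (2 * k) \<partial>haar N) = (\<Prod>n<N. x n)"
    by (simp only: of_real_eq_iff)
  moreover have "(\<Prod>n<N. x n) > 0" by (intro prod_pos) (use x in auto)
  moreover have "(\<Prod>n<N. factor_mellin k 0 n) = complex_of_real (\<Prod>n<N. x n)" by (simp add: x(2))
  ultimately show ?thesis using that 1 by blast
qed

subsection \<open>Asymptotics of the product\<close>

text \<open>The term \<open>a^2 / (n + 1)\<close> is not summable; splitting it off as an
  exponential leaves factors whose distance to 1 is summable, uniformly for
  \<open>\<bar>\<tau>\<bar> \<le> 1\<close>.\<close>

definition normalized_factor :: "nat \<Rightarrow> real \<Rightarrow> nat \<Rightarrow> complex" where
  "normalized_factor k \<tau> n = factor_mellin k \<tau> n * exp (- ((mellin_exponent k \<tau>)\<^sup>2 / of_nat (Suc n)))"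

text \<open>Multiplication by \<open>exp (- x)\<close> cancels \<open>1 + x\<close> up to an error
  quadratic in \<open>x\<close>, of order \<open>(n + 1)^(-2)\<close>, which is dominated by the
  exponent \<open>-3/2\<close> of the factor estimate.\<close>

lemma normalized_factor_approx:
  obtains C where "C \<ge> 0" "\<And>(\<tau>::real) n. \<bar>\<tau>\<bar> \<le> 1 \<Longrightarrow>
    cmod (normalized_factor k \<tau> n - 1) \<le> C * real (Suc n) powr (-3/2)"
proof -
  obtain C where C: "C \<ge> 0" "\<And>(\<tau>::real) n. \<bar>\<tau>\<bar> \<le> 1 \<Longrightarrow>
    cmod (factor_mellin k \<tau> n - (1 + (mellin_exponent k \<tau>)\<^sup>2 / of_nat (Suc n))) \<le> C * real (Suc n) powr (-3/2)"
    using factor_mellin_approx[of k] by blast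
  define K where "K = (real k + 1)\<^sup>2"
  have K: "K \<ge> 0" by (simp add: K_def)
  have "cmod (normalized_factor k \<tau> n - 1) \<le> (C * exp K + exp K * (exp K * K\<^sup>2)) * real (Suc n) powr (-3/2)"
    if tau: "\<bar>\<tau>\<bar> \<le> 1" for \<tau> n
  proof -
    define x where "x = (mellin_exponent k \<tau>)\<^sup>2 / of_nat (Suc n)"
    have "cmod ((mellin_exponent k \<tau>)\<^sup>2) \<le> K"
      unfolding norm_power K_def using norm_mellin_exponent[OF tau] by (intro power_mono) auto
    then have xN: "cmod x \<le> K / real (Suc n)"
      unfolding x_def norm_divide norm_of_nat by (rule divide_right_mono) simp
    also have "\<dots> \<le> K" using K by (simp add: field_simps)
    finally have xK: "cmod x \<le> K" .
    have e: "cmod (exp (- x)) \<le> exp K"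
      using norm_exp[of "- x"] xK by (simp add: order_trans)
    have "cmod (exp x - (\<Sum>i\<le>1. x ^ i / fact i)) \<le> exp (cmod x) * cmod x ^ Suc 1 / fact 1"
      by (rule Taylor_exp_field)
    then have "cmod (exp x - (1 + x)) \<le> exp (cmod x) * (cmod x)\<^sup>2" by (simp add: eval_nat_numeral)
    also have "\<dots> \<le> exp K * (K / real (Suc n))\<^sup>2"
      using xK xN by (intro mult_mono power_mono) auto
    also have "\<dots> = exp K * K\<^sup>2 * (1 / real (Suc n))\<^sup>2" by (simp add: power_divide)
    also have "(1 / real (Suc n))\<^sup>2 = real (Suc n) powr (-2)"
      by (simp add: powr_minus powr_numeral power_one_over inverse_eq_divide)
    also have "\<dots> \<le> real (Suc n) powr (-3/2)" by (rule powr_mono) auto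
    finally have t: "cmod (exp x - (1 + x)) \<le> exp K * K\<^sup>2 * real (Suc n) powr (-3/2)"
      by (simp add: mult_left_mono)
    have "normalized_factor k \<tau> n - 1 = (factor_mellin k \<tau> n - (1 + x)) * exp (- x) - exp (- x) * (exp x - (1 + x))"
      unfolding normalized_factor_def x_def[symmetric] by (simp add: algebra_simps flip: exp_add)
    also have "cmod \<dots> \<le> cmod (factor_mellin k \<tau> n - (1 + x)) * cmod (exp (- x)) + cmod (exp (- x)) * cmod (exp x - (1 + x))"
      using norm_triangle_ineq4 by (metis norm_mult)
    also have "\<dots> \<le> (C * real (Suc n) powr (-3/2)) * exp K + exp K * (exp K * K\<^sup>2 * real (Suc n) powr (-3/2))"
      using C(2)[OF tau, of n] e t C(1) by (intro add_mono mult_mono) (auto simp: x_def)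
    finally show ?thesis by (simp only: algebra_simps)
  qed
  moreover have "C * exp K + exp K * (exp K * K\<^sup>2) \<ge> 0" using C by simp
  ultimately show ?thesis using that by blast
qed

lemma summable_Suc_powr: "summable (\<lambda>n. real (Suc n) powr (-3/2))"
  using summable_real_powr_iff[of "-3/2"] by (subst summable_Suc_iff) simp

text \<open>The factors are nonzero and tend to 1, so their inverses converge and are therefore
  bounded. The quotients by the untwisted factors thus inherit a summable majorant.\<close>

lemma normalized_factor_0_bound:
  obtains M where "M \<ge> 0" "\<And>n. normalized_factor k 0 n \<noteq> 0" "\<And>n. cmod (inverse (normalized_factor k 0 n)) \<le> M"
proof -
  obtain C where C: "C \<ge> 0" "\<And>(\<tau>::real) n. \<bar>\<tau>\<bar> \<le> 1 \<Longrightarrow>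
    cmod (normalized_factor k \<tau> n - 1) \<le> C * real (Suc n) powr (-3/2)"
    using normalized_factor_approx[of k] by blast
  have nz: "normalized_factor k 0 n \<noteq> 0" for n
    using factor_mellin_0[of k n] by (auto simp: normalized_factor_def)
  have "(\<lambda>n. C * real (Suc n) powr (-3/2)) \<longlonglongrightarrow> 0"
    by (rule summable_LIMSEQ_zero[OF summable_mult[OF summable_Suc_powr]])
  then have "(\<lambda>n. normalized_factor k 0 n - 1) \<longlonglongrightarrow> 0"
    by (rule Lim_null_comparison[rotated]) (use C(2)[of 0] in auto)
  then have "(\<lambda>n. normalized_factor k 0 n) \<longlonglongrightarrow> 1" by (simp add: LIM_zero_iff)
  then have "(\<lambda>n. inverse (normalized_factor k 0 n)) \<longlonglongrightarrow> inverse 1" by (rule tendsto_inverse) simp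
  then have "Bseq (\<lambda>n. inverse (normalized_factor k 0 n))"
    by (intro convergent_imp_Bseq) (auto simp: convergent_def)
  then obtain M where "M > 0" "\<And>n. cmod (inverse (normalized_factor k 0 n)) \<le> M"
    by (auto elim: BseqE)
  then show ?thesis using that nz by (metis less_imp_le)
qed

text \<open>Each quotient tends to 1 for fixed \<open>n\<close>, and its distance to 1 has a
  summable majorant in \<open>n\<close> independent of \<open>N\<close>. Tannery's theorem sends the
  sum of the distances to 0, and the distance of the product to 1 is at most the exponential of that
  sum, minus 1.\<close>

lemma normalized_product_tendsto_1:
  assumes tau: "\<tau> \<longlonglongrightarrow> 0"
  shows "(\<lambda>N. \<Prod>n<N. normalized_factor k (\<tau> N) n / normalized_factor k 0 n) \<longlonglongrightarrow> 1"
proof -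
  obtain C where C: "C \<ge> 0" "\<And>(\<tau>::real) n. \<bar>\<tau>\<bar> \<le> 1 \<Longrightarrow>
    cmod (normalized_factor k \<tau> n - 1) \<le> C * real (Suc n) powr (-3/2)"
    using normalized_factor_approx[of k] by blast
  obtain M where M: "M \<ge> 0" "\<And>n. normalized_factor k 0 n \<noteq> 0" "\<And>n. cmod (inverse (normalized_factor k 0 n)) \<le> M"
    using normalized_factor_0_bound[of k] by blast
  define c where "c N n = normalized_factor k (\<tau> N) n / normalized_factor k 0 n" for N n
  \<comment> \<open>Both cutoffs make the majorant valid for every pair of indices; the one on
    \<open>\<tau> N\<close> is eventually inactive.\<close>
  define a where "a n N = (if n < N \<and> \<bar>\<tau> N\<bar> \<le> 1 then cmod (c N n - 1) else 0)" for n N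
  have ev: "eventually (\<lambda>N. \<bar>\<tau> N\<bar> \<le> 1) sequentially"
    using tendstoD[OF tau, of 1] by (auto elim: eventually_mono simp: dist_real_def)
  have bound: "norm (a n N) \<le> 2 * C * M * real (Suc n) powr (-3/2)" for n N
  proof (cases "n < N \<and> \<bar>\<tau> N\<bar> \<le> 1")
    case True
    have "c N n - 1 = ((normalized_factor k (\<tau> N) n - 1) - (normalized_factor k 0 n - 1)) * inverse (normalized_factor k 0 n)"
      using M(2)[of n] by (simp add: c_def field_simps)
    also have "cmod \<dots> \<le> (C * real (Suc n) powr (-3/2) + C * real (Suc n) powr (-3/2)) * M"
      unfolding norm_mult using True M C(1) 
      by (intro mult_mono order_trans[OF norm_triangle_ineq4] add_mono C(2)) auto
    finally show ?thesis using True by (simp add: a_def algebra_simps)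
  next
    case False
    then have "a n N = 0" by (auto simp: a_def)
    then show ?thesis using C(1) M(1) by simp
  qed
  have lim: "(\<lambda>N. a n N) \<longlonglongrightarrow> 0" for n
  proof (rule Lim_null_comparison)
    show "eventually (\<lambda>N. norm (a n N) \<le> cmod (c N n - 1)) sequentially"
      by (auto simp: a_def)
    have "(\<lambda>N. mellin_exponent k (\<tau> N)) \<longlonglongrightarrow> mellin_exponent k 0"
      unfolding mellin_exponent_def by (intro tendsto_intros tau) auto
    then have "(\<lambda>N. normalized_factor k (\<tau> N) n) \<longlonglongrightarrow> normalized_factor k 0 n"
      unfolding normalized_factor_def by (intro tendsto_intros factor_mellin_tendsto[OF tau]) (auto simp del: of_nat_Suc)
    then have "(\<lambda>N. c N n) \<longlonglongrightarrow> normalized_factor k 0 n / normalized_factor k 0 n"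
      unfolding c_def by (intro tendsto_intros M(2))
    then show "(\<lambda>N. cmod (c N n - 1)) \<longlonglongrightarrow> 0"
      using M(2)[of n] by (simp add: tendsto_norm_zero LIM_zero)
  qed
  have "(\<lambda>N. suminf (\<lambda>n. a n N)) \<longlonglongrightarrow> suminf (\<lambda>n. 0::real)"
    by (rule tannerys_theorem[OF lim _ summable_mult[OF summable_Suc_powr, of "2 * C * M"], THEN conjunct2, THEN conjunct2])
      (use bound in \<open>auto intro: always_eventually\<close>)
  then have "(\<lambda>N. exp (suminf (\<lambda>n. a n N)) - 1) \<longlonglongrightarrow> 0"
    by (auto intro!: tendsto_eq_intros)
  moreover have "eventually (\<lambda>N. norm ((\<Prod>n<N. c N n) - 1) \<le> exp (suminf (\<lambda>n. a n N)) - 1) sequentially"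
    using ev
  proof eventually_elim
    case (elim N)
    have "suminf (\<lambda>n. a n N) = (\<Sum>n<N. a n N)" by (rule suminf_finite) (auto simp: a_def)
    also have "\<dots> = (\<Sum>n<N. cmod (c N n - 1))" using elim by (intro sum.cong) (auto simp: a_def)
    finally have s: "suminf (\<lambda>n. a n N) = (\<Sum>n<N. cmod (c N n - 1))" .
    have "norm ((\<Prod>n<N. 1 + (c N n - 1)) - 1) \<le> (\<Prod>n<N. 1 + cmod (c N n - 1)) - 1"
      by (rule norm_prod_minus1_le_prod_minus1)
    also have "(\<Prod>n<N. 1 + cmod (c N n - 1)) \<le> exp (\<Sum>n<N. cmod (c N n - 1))"
      by (rule prod_le_exp_sum) simp
    finally show ?case by (simp add: s)
  qed
  ultimately have "(\<lambda>N. (\<Prod>n<N. c N n) - 1) \<longlonglongrightarrow> 0"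
    by (rule Lim_null_comparison[rotated])
  then show ?thesis by (simp add: c_def LIM_zero_iff)
qed

text \<open>The split-off exponentials combine exactly, with \<open>harm N\<close> in place of
  \<open>log N\<close>; replacing one by the other is left to the limit.\<close>

lemma factor_product_eq:
  "(\<Prod>n<N. factor_mellin k \<tau> n) / (\<Prod>n<N. factor_mellin k 0 n)
   = exp ((\<i> * of_real (real k * \<tau>) - of_real (\<tau>\<^sup>2 / 4)) * of_real (harm N))
     * (\<Prod>n<N. normalized_factor k \<tau> n / normalized_factor k 0 n)"
proof -
  have f: "factor_mellin k \<tau> n = exp ((mellin_exponent k \<tau>)\<^sup>2 / of_nat (Suc n)) * normalized_factor k \<tau> n" for \<tau> n
    unfolding normalized_factor_def by (simp add: mult.left_commute[of "exp _"] flip: exp_add)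
  have d: "(mellin_exponent k \<tau>)\<^sup>2 - (mellin_exponent k 0)\<^sup>2 = \<i> * of_real (real k * \<tau>) - of_real (\<tau>\<^sup>2 / 4)"
    unfolding mellin_exponent_def by (simp add: power2_eq_square algebra_simps)
  have r: "factor_mellin k \<tau> n / factor_mellin k 0 n
     = exp ((\<i> * of_real (real k * \<tau>) - of_real (\<tau>\<^sup>2 / 4)) * of_real (inverse (real (Suc n))))
       * (normalized_factor k \<tau> n / normalized_factor k 0 n)" for n
  proof -
    have "factor_mellin k \<tau> n / factor_mellin k 0 n
      = exp ((mellin_exponent k \<tau>)\<^sup>2 / of_nat (Suc n) - (mellin_exponent k 0)\<^sup>2 / of_nat (Suc n))
       * (normalized_factor k \<tau> n / normalized_factor k 0 n)"
      unfolding f exp_diff by (simp only: times_divide_times_eq)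
    also have "(mellin_exponent k \<tau>)\<^sup>2 / of_nat (Suc n) - (mellin_exponent k 0)\<^sup>2 / of_nat (Suc n)
      = (\<i> * of_real (real k * \<tau>) - of_real (\<tau>\<^sup>2 / 4)) * of_real (inverse (real (Suc n)))"
      by (simp only: diff_divide_distrib[symmetric] d of_real_inverse of_real_of_nat_eq)
        (rule divide_inverse)
    finally show ?thesis .
  qed
  have "harm N = (\<Sum>n<N. inverse (real (Suc n)))"
    unfolding harm_def by (rule sum.reindex_bij_witness[of _ Suc "\<lambda>n. n - 1"]) auto
  then show ?thesis
    unfolding prod_dividef[symmetric] r prod.distrib
    by (simp only: of_real_sum sum_distrib_left exp_sum[OF finite_lessThan])
qed


section \<open>The tilted measure, its characteristic functions and the Gaussian limit\<close>

lemma cdf_std_normal_reflect: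
  "cdf std_normal_distribution (- V) = (LBINT x:{V..}. exp (- x\<^sup>2 / 2) / sqrt (2 * pi))"
proof -
  let ?d = "std_normal_density"
  interpret real_distribution std_normal_distribution by (rule real_dist_normal_dist)
  have "cdf std_normal_distribution (- V) = (\<integral>x. indicator {..- V} x \<partial>std_normal_distribution)"
    by (simp add: cdf_def)
  also have "\<dots> = (\<integral>x. ?d x *\<^sub>R indicator {..- V} x \<partial>lborel)"
    by (rule integral_density) (auto simp: normal_density_nonneg)
  also have "\<dots> = (\<integral>x. ?d (- x) * indicator {..- V} (- x) \<partial>lborel)"
    using lborel_integral_real_affine[of "-1" "\<lambda>x. ?d x *\<^sub>R (indicator {..- V} x :: real)" 0] by simp
  also have "\<dots> = (LBINT x:{V..}. exp (- x\<^sup>2 / 2) / sqrt (2 * pi))"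
    unfolding set_lebesgue_integral_def
    by (rule Bochner_Integration.integral_cong) (auto simp: std_normal_density_def indicator_def)
  finally show ?thesis .
qed

text \<open>A measure with a density has no atoms. Weak convergence therefore yields convergence of
  distribution functions at every point.\<close>

lemma isCont_cdf_std_normal: "isCont (cdf std_normal_distribution) x"
proof -
  interpret real_distribution std_normal_distribution by (rule real_dist_normal_dist)
  have "{x} \<in> null_sets lborel" by (simp add: null_sets_def)
  then have "{x} \<in> null_sets std_normal_distribution"
    using absolutely_continuousI_density[of "\<lambda>x. ennreal (std_normal_density x)" lborel]
    by (auto simp: absolutely_continuous_def)
  then have "measure std_normal_distribution {x} = 0" by (simp add: measure_eq_0_null_sets)
  then show ?thesis by (simp add: isCont_cdf)
qed

definition tilted_haar :: "nat \<Rightarrow> nat \<Rightarrow> real \<Rightarrow> (nat \<times> nat \<Rightarrow> complex) measure" where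
  "tilted_haar k N \<theta> = density (haar N) (\<lambda>U. ennreal (cmod (charpoly_Z N U \<theta>) ^ (2 * k) /
     (\<integral>U. cmod (charpoly_Z N U \<theta>) ^ (2 * k) \<partial>haar N)))"

lemma prob_space_tilted_haar: "prob_space (tilted_haar k N \<theta>)"
proof
  obtain m where m: "m > 0" "integrable (haar N) (\<lambda>U. cmod (charpoly_Z N U \<theta>) ^ (2 * k))"
    "(\<integral>U. cmod (charpoly_Z N U \<theta>) ^ (2 * k) \<partial>haar N) = m"
    using haar_moment by blast
  have "emeasure (tilted_haar k N \<theta>) (space (tilted_haar k N \<theta>))
      = (\<integral>\<^sup>+U. ennreal (cmod (charpoly_Z N U \<theta>) ^ (2 * k) / m) \<partial>haar N)"
    unfolding tilted_haar_def m(3) by (subst emeasure_density) (auto intro!: nn_integral_cong)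
  also have "\<dots> = ennreal (\<integral>U. cmod (charpoly_Z N U \<theta>) ^ (2 * k) / m \<partial>haar N)"
    using m by (intro nn_integral_eq_integral integrable_divide) auto
  also have "\<dots> = 1" using m by simp
  finally show "emeasure (tilted_haar k N \<theta>) (space (tilted_haar k N \<theta>)) = 1" .
qed

lemma integral_tilted_haar:
  fixes f :: "_ \<Rightarrow> 'b :: {banach, second_countable_topology}"
  assumes "f \<in> borel_measurable (haar N)"
  shows "(\<integral>U. f U \<partial>tilted_haar k N \<theta>) = (\<integral>U. (cmod (charpoly_Z N U \<theta>) ^ (2 * k) /
     (\<integral>U. cmod (charpoly_Z N U \<theta>) ^ (2 * k) \<partial>haar N)) *\<^sub>R f U \<partial>haar N)"
  unfolding tilted_haar_def using assms by (intro integral_density) (auto intro!: divide_nonneg_nonneg integral_nonneg_AE)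

text \<open>The sign is reversed because a distribution function measures closed lower half-lines,
  while the event of interest is a closed upper one.\<close>

definition neg_standardized :: "nat \<Rightarrow> nat \<Rightarrow> real \<Rightarrow> (nat \<times> nat \<Rightarrow> complex) \<Rightarrow> real" where
  "neg_standardized k N \<theta> U = - ((ln (cmod (charpoly_Z N U \<theta>)) - real k * ln (real N)) / sqrt (1/2 * ln (real N)))"

lemma measurable_neg_standardized [measurable]: "neg_standardized k N \<theta> \<in> borel_measurable (haar N)"
  unfolding neg_standardized_def[abs_def] by measurable

lemma measurable_tilted_haar: "f \<in> measurable (haar N) M \<Longrightarrow> f \<in> measurable (tilted_haar k N \<theta>) M"
  by (simp add: tilted_haar_def)

text \<open>The variable \<open>t\<close> becomes the frequency \<open>\<tau> t N\<close> of the
  kernel, and the centring becomes a constant phase that combines with the harmonic number to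
  \<open>harm N - ln N\<close>. For \<open>N \<le> 1\<close> division by zero gives
  \<open>\<tau> t N = 0\<close>, and both sides are 1.\<close>

lemma char_neg_standardized:
  defines "\<tau> \<equiv> \<lambda>t N. - t / sqrt (1/2 * ln (real N))"
  shows "char (distr (tilted_haar k N \<theta>) borel (neg_standardized k N \<theta>)) t
    = exp (\<i> * of_real (real k * (\<tau> t N * (harm N - ln (real N)))) - of_real ((\<tau> t N)\<^sup>2 * harm N / 4))
      * (\<Prod>n<N. normalized_factor k (\<tau> t N) n / normalized_factor k 0 n)"
proof -
  let ?t = "\<tau> t N" and ?Z = "\<lambda>U. cmod (charpoly_Z N U \<theta>)"
  obtain m where m: "m > 0" "(\<integral>U. ?Z U ^ (2 * k) \<partial>haar N) = m" "(\<Prod>n<N. factor_mellin k 0 n) = complex_of_real m"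
    using haar_moment[of N \<theta> k] by metis
  have "char (distr (tilted_haar k N \<theta>) borel (neg_standardized k N \<theta>)) t
      = (\<integral>U. iexp (t * neg_standardized k N \<theta> U) \<partial>tilted_haar k N \<theta>)"
    unfolding char_def by (subst integral_distr) (auto intro: measurable_tilted_haar)
  also have "\<dots> = (\<integral>U. (?Z U ^ (2 * k) / m) *\<^sub>R iexp (t * neg_standardized k N \<theta> U) \<partial>haar N)"
    by (subst integral_tilted_haar) (auto simp: m(2))
  also have "\<dots> = (\<integral>U. (cis (- (?t * (real k * ln (real N)))) / of_real m) * mellin_kernel k ?t (?Z U) \<partial>haar N)"
  proof (rule integral_cong_AE)
    show "AE U in haar N. (?Z U ^ (2 * k) / m) *\<^sub>R iexp (t * neg_standardized k N \<theta> U)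
        = (cis (- (?t * (real k * ln (real N)))) / of_real m) * mellin_kernel k ?t (?Z U)"
      using haar_charpoly_nonzero[of N \<theta>]
    proof eventually_elim
      case (elim U)
      have "t * neg_standardized k N \<theta> U = - (?t * (real k * ln (real N))) + ?t * ln (?Z U)"
        by (simp add: neg_standardized_def \<tau>_def diff_divide_distrib algebra_simps)
      then have "iexp (t * neg_standardized k N \<theta> U) = cis (- (?t * (real k * ln (real N)))) * cis (?t * ln (?Z U))"
        by (simp only: cis_conv_exp[symmetric] cis_mult)
      then show ?case using elim by (simp only: mellin_kernel_def scaleR_conv_of_real) simp
    qed
  qed auto
  also have "\<dots> = cis (- (?t * (real k * ln (real N)))) * ((\<Prod>n<N. factor_mellin k ?t n) / (\<Prod>n<N. factor_mellin k 0 n))"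
    by (simp add: haar_mellin m(3))
  also have "\<dots> = (cis (- (?t * (real k * ln (real N))))
      * exp ((\<i> * of_real (real k * ?t) - of_real (?t\<^sup>2 / 4)) * of_real (harm N)))
      * (\<Prod>n<N. normalized_factor k ?t n / normalized_factor k 0 n)"
    unfolding factor_product_eq by (simp only: mult.assoc)
  also have "cis (- (?t * (real k * ln (real N)))) * exp ((\<i> * of_real (real k * ?t) - of_real (?t\<^sup>2 / 4)) * of_real (harm N))
    = exp (\<i> * of_real (real k * (?t * (harm N - ln (real N)))) - of_real (?t\<^sup>2 * harm N / 4))"
    unfolding cis_conv_exp exp_add[symmetric] by (rule arg_cong[where f=exp]) (simp add: algebra_simps)
  finally show ?thesis .
qed

text \<open>The difference \<open>harm N - ln N\<close> tends to the Euler-Mascheroni constant, so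
  the phase vanishes as \<open>\<tau> N\<close> tends to 0. The variance term is
  \<open>(t^2 / 2) * (harm N / ln N)\<close> for \<open>N > 1\<close>, with limit
  \<open>t^2 / 2\<close>.\<close>

lemma char_neg_standardized_tendsto:
  "(\<lambda>N. char (distr (tilted_haar k N \<theta>) borel (neg_standardized k N \<theta>)) t) \<longlonglongrightarrow> char std_normal_distribution t"
proof -
  define \<tau> where "\<tau> N = - t / sqrt (1/2 * ln (real N))" for N
  have ln_lim: "filterlim (\<lambda>N. ln (real N)) at_top sequentially"
    by (rule filterlim_compose[OF ln_at_top filterlim_real_sequentially])
  have "filterlim (\<lambda>N. sqrt (1/2 * ln (real N))) at_top sequentially"
    by (intro filterlim_compose[OF sqrt_at_top] filterlim_tendsto_pos_mult_at_top[OF tendsto_const _ ln_lim]) simp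
  then have tau: "\<tau> \<longlonglongrightarrow> 0"
    unfolding \<tau>_def by (intro tendsto_divide_0[OF tendsto_const] filterlim_at_top_imp_at_infinity)
  have h: "(\<lambda>N. harm N - ln (real N)) \<longlonglongrightarrow> euler_mascheroni"
    using euler_mascheroni_LIMSEQ by simp
  have "(\<lambda>N. (harm N - ln (real N)) / ln (real N)) \<longlonglongrightarrow> 0"
    by (rule tendsto_divide_0[OF h filterlim_at_top_imp_at_infinity[OF ln_lim]])
  then have "(\<lambda>N. t\<^sup>2 / 2 * (1 + (harm N - ln (real N)) / ln (real N))) \<longlonglongrightarrow> t\<^sup>2 / 2 * (1 + 0)"
    by (intro tendsto_intros)
  then have "(\<lambda>N. t\<^sup>2 / 2 * (1 + (harm N - ln (real N)) / ln (real N))) \<longlonglongrightarrow> t\<^sup>2 / 2"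
    by simp
  moreover have "eventually (\<lambda>N. t\<^sup>2 / 2 * (1 + (harm N - ln (real N)) / ln (real N)) = (\<tau> N)\<^sup>2 * harm N / 4) sequentially"
    using eventually_gt_at_top[of 1]
  proof eventually_elim
    case (elim N)
    then have pos: "ln (real N) > 0" by simp
    then have "(\<tau> N)\<^sup>2 = t\<^sup>2 / (1/2 * ln (real N))" by (simp add: \<tau>_def power_divide)
    with pos show ?case by (simp add: field_simps)
  qed
  ultimately have q: "(\<lambda>N. (\<tau> N)\<^sup>2 * harm N / 4) \<longlonglongrightarrow> t\<^sup>2 / 2"
    by (rule Lim_transform_eventually)
  have "(\<lambda>N. exp (\<i> * of_real (real k * (\<tau> N * (harm N - ln (real N)))) - of_real ((\<tau> N)\<^sup>2 * harm N / 4))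
      * (\<Prod>n<N. normalized_factor k (\<tau> N) n / normalized_factor k 0 n))
    \<longlonglongrightarrow> exp (\<i> * of_real (real k * (0 * euler_mascheroni)) - of_real (t\<^sup>2 / 2)) * 1"
    by (intro tendsto_mult tendsto_exp tendsto_diff tendsto_of_real tendsto_const tau h q normalized_product_tendsto_1)
  also have "exp (\<i> * of_real (real k * (0 * euler_mascheroni)) - of_real (t\<^sup>2 / 2)) * 1 = char std_normal_distribution t"
    by (simp add: char_std_normal_distribution flip: exp_of_real)
  finally show ?thesis
    unfolding char_neg_standardized \<tau>_def .
qed

theorem theorem3:
  fixes k :: nat and \<theta> V :: real
  shows "(\<lambda>N. (\<integral>U. norm (charpoly_Z N U \<theta>) ^ (2*k) *
                indicator {U. (ln (norm (charpoly_Z N U \<theta>)) - real k * ln (real N))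
                               / sqrt (1/2 * ln (real N)) \<ge> V} U \<partial>haar N)
            / (\<integral>U. norm (charpoly_Z N U \<theta>) ^ (2*k) \<partial>haar N))
         \<longlonglongrightarrow> (LBINT x:{V..}. exp (- x\<^sup>2 / 2) / sqrt (2 * pi))"
proof -
  let ?D = "\<lambda>N. distr (tilted_haar k N \<theta>) borel (neg_standardized k N \<theta>)"
  have D: "real_distribution (?D N)" for N
    by (intro prob_space.real_distribution_distr prob_space_tilted_haar measurable_tilted_haar measurable_neg_standardized)
  have "weak_conv_m ?D std_normal_distribution"
    by (rule levy_continuity[OF D real_dist_normal_dist char_neg_standardized_tendsto])
  then have "(\<lambda>N. cdf (?D N) (- V)) \<longlonglongrightarrow> cdf std_normal_distribution (- V)"
    using isCont_cdf_std_normal by (simp add: weak_conv_m_def weak_conv_def)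
  moreover have "cdf (?D N) (- V) = (\<integral>U. norm (charpoly_Z N U \<theta>) ^ (2*k) *
                indicator {U. (ln (norm (charpoly_Z N U \<theta>)) - real k * ln (real N))
                               / sqrt (1/2 * ln (real N)) \<ge> V} U \<partial>haar N)
            / (\<integral>U. norm (charpoly_Z N U \<theta>) ^ (2*k) \<partial>haar N)" for N
  proof -
    interpret real_distribution "?D N" by (rule D)
    have "cdf (?D N) (- V) = (\<integral>x. indicator {..- V} x \<partial>?D N)"
      by (simp add: cdf_def)
    also have "\<dots> = (\<integral>U. indicator {..- V} (neg_standardized k N \<theta> U) \<partial>tilted_haar k N \<theta>)"
      by (rule integral_distr) (auto intro: measurable_tilted_haar)
    also have "\<dots> = (\<integral>U. (cmod (charpoly_Z N U \<theta>) ^ (2 * k) /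
         (\<integral>U. cmod (charpoly_Z N U \<theta>) ^ (2 * k) \<partial>haar N)) *\<^sub>R indicator {..- V} (neg_standardized k N \<theta> U) \<partial>haar N)"
      by (rule integral_tilted_haar) measurable
    also have "\<dots> = (\<integral>U. norm (charpoly_Z N U \<theta>) ^ (2*k) *
                indicator {U. (ln (norm (charpoly_Z N U \<theta>)) - real k * ln (real N))
                               / sqrt (1/2 * ln (real N)) \<ge> V} U
            / (\<integral>U. norm (charpoly_Z N U \<theta>) ^ (2*k) \<partial>haar N) \<partial>haar N)"
      \<comment> \<open>The condition \<open>neg_standardized k N \<theta> U \<le> - V\<close> is
        the event of the statement, boundary included.\<close>
      by (rule Bochner_Integration.integral_cong) (auto simp: neg_standardized_def indicator_def)
    finally show ?thesis by (simp only: integral_divide_zero)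
  qed
  ultimately show ?thesis by (simp only: cdf_std_normal_reflect)
qed

end
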